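(* Let $V$ be a Komori variety with associated invariant $n$. (i) Every finitely presentable non-trivial algebra in $V$ is a finite direct product of finitely presentable local MV-algebras in $V$. (ii) Let $A$ be a finitely presentable non-trivial algebra in $V$ and let $\{x_1,\dots,x_m\}$ be a set of generators for $A$. The $J_1$-multicomposition obtained by choosing at each step one of the generators gives a representation of $A$ as a product of local MV-algebras (i.e. the non-trivial codomains of the arrows in the resulting product diagram are local MV-algebras) if and only if the image of each generator under the projections to the product factors satisfies the sequent $\rho_n$, that is, the image of each generator $x_i$ in each factor belongs to $\mathrm{Fin}_d^n$ of that factor for some $d\in\{0,\dots,n\}$.
   Context: An MV-algebra is a structure $(A,\oplus,\neg,0)$ such that $(A,\oplus,0)$ is a commutative monoid, $\neg\neg x=x$, $x\oplus\neg 0=\neg 0$ and $\neg(\neg x\oplus y)\oplus y=\neg(\neg y\oplus x)\oplus x$. Write $1=\neg 0$, $x\odot y=\neg(\neg x\oplus\neg y)$, $d(x,y)=(x\odot\neg y)\oplus(y\odot\neg x)$, $kx=x\oplus\cdots\oplus x$ and $x^k=x\odot\cdots\odot x$ ($k$ times). An MV-algebra is local if it is non-trivial and for every $x$ there is $k\ge 1$ with $kx=1$ or $k(\neg x)=1$. For $a\in A$, $A/(a)$ is the quotient of $A$ by the ideal generated by $a$ (equivalently by the congruence generated by $a=0$). For a lattice-ordered abelian group $G$ and $u\ge 0$ in $G$, $\Gamma(G,u)$ is the MV-algebra on $[0,u]$ with $x\oplus y=\inf(x+y,u)$, $\neg x=u-x$. By Mundici's equivalence every MV-algebra is of this form with $u$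 a strong unit. For $m\ge 1$, $S_m=\Gamma(\mathbb{Z},m)$ and $S_m^\omega=\Gamma(\mathbb{Z}\times_{\mathrm{lex}}\mathbb{Z},(m,0))$. A Komori variety is a variety $V=V(\{S_i\}_{i\in I},\{S_j^\omega\}_{j\in J})$ generated by these algebras, with $I,J$ finite sets of positive integers, not both empty. Its invariant is $n=\mathrm{l.c.m.}(I\cup J)$, which depends only on $V$. Finitely presentable algebras in $V$ are the finitely presentable models of the algebraic theory of $V$. Formulae $x\in\mathrm{Fin}_d^n$ ($0\le d\le n$). $x\in\mathrm{Fin}_0^n$ means $((n+1)x)^2=0$. For $1\le d\le n$ let $D=\gcd(d,n)$ and let $\xi,\chi$ be the unique natural numbers with $0\le\xi\le n/D$, $0\le\chi\le d/D$, $D=\xi d-\chi n$. Let $D_{d,n}^x$ be the MV-term in $x$ whose value in $\Gamma(G,u)$ is $\inf(u,\sup(0,\xi x-\chi u))$, computed in $G$; equivalently it is the $(\chi+1)$-th component of the sum of $\xi$ copies of the sequence $(x,0,0,\dots)$, where the sum $c$ of sequences $a,b$ is given by $c_i=a_i\oplus(a_{i-1}\odot b_1)\oplus\cdots\oplus(a_1\odot b_{i-1})\oplus b_i$. Write $z\equiv w$ for $((n+1)d(z,w))^2=0$. Then $x\in\mathrm{Fin}_d^n$ is the formula $(x\equiv\frac{d}{D}D_{d,n}^x)\wedge\bigwedge_{k=0}^{n/D}\big(\neg(kD_{d,n}^x)\equiv(\frac{n}{D}-k)D_{d,n}^x\big)$. The sequent $\rho_n$ is $(\top\vdash_x\bigvee_{d=0}^n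 x\in\mathrm{Fin}_d^n)$. $J_1$-multicomposition relative to $x_1,\dots,x_m\in A$: start with $A$; at step $i=1,\dots,m$ replace each algebra $B$ obtained so far (a quotient of $A$) by the two quotients $B/(((n+1)\bar x_i)^2)$ and $B/(\neg((n+1)\bar x_i)^2)$, where $\bar x_i$ is the image of $x_i$ in $B$. The resulting composite quotient maps from $A$ to the $2^m$ final algebras exhibit $A$ as the direct product of these final algebras (some of which may be trivial); these are the projections and product factors referred to in (ii). *)

theory Defs
  imports Main "HOL-Library.FuncSet" "HOL-Library.Lattice_Algebras"
    "HOL-Library.Product_Plus" "HOL-Library.Product_Lexorder"
begin

section \<open>MV-algebras\<close>

record 'a mv =
  carr :: "'a set"
  mv_plus :: "'a \<Rightarrow> 'a \<Rightarrow> 'a" (infixl \<open>\<oplus>\<index>\<close> 65)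
  mv_neg :: "'a \<Rightarrow> 'a" (\<open>\<sim>\<index> _\<close> [81] 80)
  mv_zero :: "'a" (\<open>\<zero>\<index>\<close>)

locale mv_algebra =
  fixes A :: "'a mv" (structure)
  assumes zero_closed: "\<zero> \<in> carr A"
    and neg_closed: "x \<in> carr A \<Longrightarrow> \<sim> x \<in> carr A"
    and plus_closed: "x \<in> carr A \<Longrightarrow> y \<in> carr A \<Longrightarrow> x \<oplus> y \<in> carr A"
    and plus_assoc: "x \<in> carr A \<Longrightarrow> y \<in> carr A \<Longrightarrow> z \<in> carr A \<Longrightarrow> (x \<oplus> y) \<oplus> z = x \<oplus> (y \<oplus> z)"
    and plus_comm: "x \<in> carr A \<Longrightarrow> y \<in> carr A \<Longrightarrow> x \<oplus> y = y \<oplus> x"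
    and plus_zero: "x \<in> carr A \<Longrightarrow> x \<oplus> \<zero> = x"
    and neg_neg: "x \<in> carr A \<Longrightarrow> \<sim> (\<sim> x) = x"
    and plus_neg_zero: "x \<in> carr A \<Longrightarrow> x \<oplus> \<sim> \<zero> = \<sim> \<zero>"
    and lukasiewicz: "x \<in> carr A \<Longrightarrow> y \<in> carr A \<Longrightarrow>
      \<sim> (\<sim> x \<oplus> y) \<oplus> y = \<sim> (\<sim> y \<oplus> x) \<oplus> x"

definition mv_one :: "'a mv \<Rightarrow> 'a" (\<open>\<one>\<index>\<close>) where
  "\<one>\<^bsub>A\<^esub> = \<sim>\<^bsub>A\<^esub> \<zero>\<^bsub>A\<^esub>"

definition mv_times :: "'a mv \<Rightarrow> 'a \<Rightarrow> 'a \<Rightarrow> 'a" (infixl \<open>\<odot>\<index>\<close> 70) where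
  "x \<odot>\<^bsub>A\<^esub> y = \<sim>\<^bsub>A\<^esub> (\<sim>\<^bsub>A\<^esub> x \<oplus>\<^bsub>A\<^esub> \<sim>\<^bsub>A\<^esub> y)"

definition mv_dist :: "'a mv \<Rightarrow> 'a \<Rightarrow> 'a \<Rightarrow> 'a" where
  "mv_dist A x y = (x \<odot>\<^bsub>A\<^esub> \<sim>\<^bsub>A\<^esub> y) \<oplus>\<^bsub>A\<^esub> (y \<odot>\<^bsub>A\<^esub> \<sim>\<^bsub>A\<^esub> x)"

definition mv_le :: "'a mv \<Rightarrow> 'a \<Rightarrow> 'a \<Rightarrow> bool" where
  "mv_le A x y \<longleftrightarrow> \<sim>\<^bsub>A\<^esub> x \<oplus>\<^bsub>A\<^esub> y = \<one>\<^bsub>A\<^esub>"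

definition mv_mult :: "'a mv \<Rightarrow> nat \<Rightarrow> 'a \<Rightarrow> 'a" where
  "mv_mult A k x = ((\<lambda>y. x \<oplus>\<^bsub>A\<^esub> y) ^^ k) \<zero>\<^bsub>A\<^esub>"

definition mv_pow :: "'a mv \<Rightarrow> 'a \<Rightarrow> nat \<Rightarrow> 'a" where
  "mv_pow A x k = ((\<lambda>y. x \<odot>\<^bsub>A\<^esub> y) ^^ k) \<one>\<^bsub>A\<^esub>"

definition mv_nontrivial :: "'a mv \<Rightarrow> bool" where
  "mv_nontrivial A \<longleftrightarrow> carr A \<noteq> {\<zero>\<^bsub>A\<^esub>}"

definition mv_local :: "'a mv \<Rightarrow> bool" where
  "mv_local A \<longleftrightarrow> mv_algebra A \<and> mv_nontrivial A \<and>
    (\<forall>x\<in>carr A. \<exists>k\<ge>1. mv_mult A k x = \<one>\<^bsub>A\<^esub> \<or> mv_mult A k (\<sim>\<^bsub>A\<^esub> x) = \<one>\<^bsub>A\<^esub>)"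

definition mv_subalgebra :: "'a mv \<Rightarrow> 'a set \<Rightarrow> bool" where
  "mv_subalgebra A S \<longleftrightarrow> S \<subseteq> carr A \<and> \<zero>\<^bsub>A\<^esub> \<in> S \<and>
    (\<forall>x\<in>S. \<sim>\<^bsub>A\<^esub> x \<in> S) \<and> (\<forall>x\<in>S. \<forall>y\<in>S. x \<oplus>\<^bsub>A\<^esub> y \<in> S)"

definition mv_generates :: "'a mv \<Rightarrow> 'a set \<Rightarrow> bool" where
  "mv_generates A X \<longleftrightarrow> X \<subseteq> carr A \<and> \<Inter>{S. mv_subalgebra A S \<and> X \<subseteq> S} = carr A"

definition mv_hom :: "'a mv \<Rightarrow> 'b mv \<Rightarrow> ('a \<Rightarrow> 'b) \<Rightarrow> bool" where
  "mv_hom A B f \<longleftrightarrow> f ` carr A \<subseteq> carr B \<and> f \<zero>\<^bsub>A\<^esub> = \<zero>\<^bsub>B\<^esub> \<and>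
    (\<forall>x\<in>carr A. f (\<sim>\<^bsub>A\<^esub> x) = \<sim>\<^bsub>B\<^esub> (f x)) \<and>
    (\<forall>x\<in>carr A. \<forall>y\<in>carr A. f (x \<oplus>\<^bsub>A\<^esub> y) = f x \<oplus>\<^bsub>B\<^esub> f y)"

definition mv_iso :: "'a mv \<Rightarrow> 'b mv \<Rightarrow> ('a \<Rightarrow> 'b) \<Rightarrow> bool" where
  "mv_iso A B f \<longleftrightarrow> mv_hom A B f \<and> bij_betw f (carr A) (carr B)"

definition mv_isomorphic :: "'a mv \<Rightarrow> 'b mv \<Rightarrow> bool" where
  "mv_isomorphic A B \<longleftrightarrow> (\<exists>f. mv_iso A B f)"

definition mv_prod :: "'i set \<Rightarrow> ('i \<Rightarrow> 'a mv) \<Rightarrow> ('i \<Rightarrow> 'a) mv" where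
  "mv_prod N B = \<lparr> carr = (\<Pi>\<^sub>E i\<in>N. carr (B i)),
     mv_plus = (\<lambda>x y. \<lambda>i\<in>N. x i \<oplus>\<^bsub>B i\<^esub> y i),
     mv_neg = (\<lambda>x. \<lambda>i\<in>N. \<sim>\<^bsub>B i\<^esub> (x i)),
     mv_zero = (\<lambda>i\<in>N. \<zero>\<^bsub>B i\<^esub>) \<rparr>"


section \<open>Congruences, ideals and quotients\<close>

definition mv_congruence :: "'a mv \<Rightarrow> ('a \<times> 'a) set \<Rightarrow> bool" where
  "mv_congruence A \<theta> \<longleftrightarrow> equiv (carr A) \<theta> \<and>
    (\<forall>x y. (x, y) \<in> \<theta> \<longrightarrow> (\<sim>\<^bsub>A\<^esub> x, \<sim>\<^bsub>A\<^esub> y) \<in> \<theta>) \<and>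
    (\<forall>x y x' y'. (x, y) \<in> \<theta> \<longrightarrow> (x', y') \<in> \<theta> \<longrightarrow> (x \<oplus>\<^bsub>A\<^esub> x', y \<oplus>\<^bsub>A\<^esub> y') \<in> \<theta>)"

definition mv_cong_gen :: "'a mv \<Rightarrow> ('a \<times> 'a) set \<Rightarrow> ('a \<times> 'a) set" where
  "mv_cong_gen A R = \<Inter>{\<theta>. mv_congruence A \<theta> \<and> R \<subseteq> \<theta>}"

text \<open>
  The quotient of \<open>A\<close> by a congruence is carried by chosen representatives of the
  congruence classes instead of by the classes themselves, so that it has the same
  element type as \<open>A\<close> and quotients can be iterated. If \<open>\<theta>\<close> is an equivalence relation,
  then \<open>mv_proj \<theta> x\<close> depends only on the class of \<open>x\<close>, and \<open>mv_proj \<theta>\<close> is the quotient map.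
\<close>

definition mv_proj :: "('a \<times> 'a) set \<Rightarrow> 'a \<Rightarrow> 'a" where
  "mv_proj \<theta> x = (SOME y. (x, y) \<in> \<theta>)"

definition mv_quot :: "'a mv \<Rightarrow> ('a \<times> 'a) set \<Rightarrow> 'a mv" where
  "mv_quot A \<theta> = \<lparr> carr = mv_proj \<theta> ` carr A,
     mv_plus = (\<lambda>x y. mv_proj \<theta> (x \<oplus>\<^bsub>A\<^esub> y)),
     mv_neg = (\<lambda>x. mv_proj \<theta> (\<sim>\<^bsub>A\<^esub> x)),
     mv_zero = mv_proj \<theta> \<zero>\<^bsub>A\<^esub> \<rparr>"

definition mv_ideal :: "'a mv \<Rightarrow> 'a set \<Rightarrow> bool" where
  "mv_ideal A N \<longleftrightarrow> N \<subseteq> carr A \<and> \<zero>\<^bsub>A\<^esub> \<in> N \<and>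
    (\<forall>x\<in>N. \<forall>y\<in>N. x \<oplus>\<^bsub>A\<^esub> y \<in> N) \<and> (\<forall>x\<in>carr A. \<forall>y\<in>N. mv_le A x y \<longrightarrow> x \<in> N)"

definition mv_ideal_gen :: "'a mv \<Rightarrow> 'a \<Rightarrow> 'a set" where
  "mv_ideal_gen A a = \<Inter>{N. mv_ideal A N \<and> a \<in> N}"

definition mv_ideal_cong :: "'a mv \<Rightarrow> 'a set \<Rightarrow> ('a \<times> 'a) set" where
  "mv_ideal_cong A N = {(x, y). x \<in> carr A \<and> y \<in> carr A \<and> mv_dist A x y \<in> N}"

abbreviation mv_quot_elem :: "'a mv \<Rightarrow> 'a \<Rightarrow> 'a mv" where
  "mv_quot_elem A a \<equiv> mv_quot A (mv_ideal_cong A (mv_ideal_gen A a))"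

abbreviation mv_proj_elem :: "'a mv \<Rightarrow> 'a \<Rightarrow> 'a \<Rightarrow> 'a" where
  "mv_proj_elem A a \<equiv> mv_proj (mv_ideal_cong A (mv_ideal_gen A a))"


section \<open>Terms, equational theories and finitely presentable models\<close>

datatype mv_term = Var nat | Zero | Plus mv_term mv_term | Neg mv_term

primrec mv_eval :: "'a mv \<Rightarrow> (nat \<Rightarrow> 'a) \<Rightarrow> mv_term \<Rightarrow> 'a" where
  "mv_eval A v (Var i) = v i"
| "mv_eval A v Zero = \<zero>\<^bsub>A\<^esub>"
| "mv_eval A v (Plus s t) = mv_eval A v s \<oplus>\<^bsub>A\<^esub> mv_eval A v t"
| "mv_eval A v (Neg t) = \<sim>\<^bsub>A\<^esub> (mv_eval A v t)"

primrec mv_vars :: "mv_term \<Rightarrow> nat set" where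
  "mv_vars (Var i) = {i}"
| "mv_vars Zero = {}"
| "mv_vars (Plus s t) = mv_vars s \<union> mv_vars t"
| "mv_vars (Neg t) = mv_vars t"

definition mv_satisfies :: "'a mv \<Rightarrow> mv_term \<Rightarrow> mv_term \<Rightarrow> bool" where
  "mv_satisfies A s t \<longleftrightarrow> (\<forall>v. range v \<subseteq> carr A \<longrightarrow> mv_eval A v s = mv_eval A v t)"

definition mv_model :: "(mv_term \<times> mv_term) set \<Rightarrow> 'a mv \<Rightarrow> bool" where
  "mv_model T A \<longleftrightarrow> mv_algebra A \<and> (\<forall>(s, t)\<in>T. mv_satisfies A s t)"

definition mv_term_algebra :: "nat \<Rightarrow> mv_term mv" where
  "mv_term_algebra k =
    \<lparr> carr = {t. mv_vars t \<subseteq> {..<k}}, mv_plus = Plus, mv_neg = Neg, mv_zero = Zero \<rparr>"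

text \<open>
  The free algebra on \<open>k\<close> generators, for a set \<open>T\<close> of identities that is the full
  equational theory of some class of MV-algebras.
\<close>

definition mv_free :: "(mv_term \<times> mv_term) set \<Rightarrow> nat \<Rightarrow> mv_term mv" where
  "mv_free T k = mv_quot (mv_term_algebra k)
    (T \<inter> carr (mv_term_algebra k) \<times> carr (mv_term_algebra k))"

definition finitely_presentable :: "(mv_term \<times> mv_term) set \<Rightarrow> 'a mv \<Rightarrow> bool" where
  "finitely_presentable T A \<longleftrightarrow> mv_model T A \<and>
    (\<exists>k R. finite R \<and> R \<subseteq> carr (mv_free T k) \<times> carr (mv_free T k) \<and>
      mv_isomorphic A (mv_quot (mv_free T k) (mv_cong_gen (mv_free T k) R)))"


section \<open>Komori varieties\<close>

instance prod :: (linordered_ab_group_add, linordered_ab_group_add) lattice_ab_group_add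
  by standard (auto simp: less_eq_prod_def)

definition Gamma :: "'g::lattice_ab_group_add \<Rightarrow> 'g mv" where
  "Gamma u = \<lparr> carr = {0..u}, mv_plus = (\<lambda>x y. inf (x + y) u),
     mv_neg = (\<lambda>x. u - x), mv_zero = 0 \<rparr>"

definition S_alg :: "nat \<Rightarrow> int mv" where
  "S_alg m = Gamma (int m)"

text \<open>The order on \<open>int \<times> int\<close> is the lexicographic one of \<open>HOL-Library.Product_Lexorder\<close>.\<close>

definition S_omega_alg :: "nat \<Rightarrow> (int \<times> int) mv" where
  "S_omega_alg m = Gamma (int m, 0)"

text \<open>
  A variety is represented by its algebraic theory: the variety generated by the algebras
  \<open>S_alg i\<close> (\<open>i \<in> I\<close>) and \<open>S_omega_alg j\<close> (\<open>j \<in> J\<close>) is the smallest equational class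
  containing them, that is, the class of models of all identities they satisfy.
\<close>

definition Komori_theory :: "nat set \<Rightarrow> nat set \<Rightarrow> (mv_term \<times> mv_term) set" where
  "Komori_theory I J = {(s, t). (\<forall>i\<in>I. mv_satisfies (S_alg i) s t) \<and>
     (\<forall>j\<in>J. mv_satisfies (S_omega_alg j) s t)}"


section \<open>The formulae Fin\<close>

text \<open>Sequences are indexed from \<open>1\<close>; the value at \<open>0\<close> is irrelevant.\<close>

definition mv_seq_sum :: "'a mv \<Rightarrow> (nat \<Rightarrow> 'a) \<Rightarrow> (nat \<Rightarrow> 'a) \<Rightarrow> nat \<Rightarrow> 'a" where
  "mv_seq_sum A a b i =
    a i \<oplus>\<^bsub>A\<^esub> foldr (\<lambda>j y. (a (i - j) \<odot>\<^bsub>A\<^esub> b j) \<oplus>\<^bsub>A\<^esub> y) [1..<i] (b i)"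

definition mv_seq_single :: "'a mv \<Rightarrow> 'a \<Rightarrow> nat \<Rightarrow> 'a" where
  "mv_seq_single A x i = (if i = 1 then x else \<zero>\<^bsub>A\<^esub>)"

definition mv_seq_mult :: "'a mv \<Rightarrow> nat \<Rightarrow> 'a \<Rightarrow> nat \<Rightarrow> 'a" where
  "mv_seq_mult A k x = (mv_seq_sum A (mv_seq_single A x) ^^ k) (\<lambda>i. \<zero>\<^bsub>A\<^esub>)"

definition xi_chi :: "nat \<Rightarrow> nat \<Rightarrow> nat \<times> nat" where
  "xi_chi d n = (THE (\<xi>, \<chi>). \<xi> \<le> n div gcd d n \<and> \<chi> \<le> d div gcd d n \<and>
     int (gcd d n) = int \<xi> * int d - int \<chi> * int n)"

definition D_term :: "'a mv \<Rightarrow> nat \<Rightarrow> nat \<Rightarrow> 'a \<Rightarrow> 'a" where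
  "D_term A d n x = (case xi_chi d n of (\<xi>, \<chi>) \<Rightarrow> mv_seq_mult A \<xi> x (\<chi> + 1))"

definition mv_near :: "'a mv \<Rightarrow> nat \<Rightarrow> 'a \<Rightarrow> 'a \<Rightarrow> bool" where
  "mv_near A n z w \<longleftrightarrow> mv_pow A (mv_mult A (n + 1) (mv_dist A z w)) 2 = \<zero>\<^bsub>A\<^esub>"

definition mv_Fin :: "'a mv \<Rightarrow> nat \<Rightarrow> nat \<Rightarrow> 'a \<Rightarrow> bool" where
  "mv_Fin A n d x \<longleftrightarrow>
    (if d = 0 then mv_pow A (mv_mult A (n + 1) x) 2 = \<zero>\<^bsub>A\<^esub>
     else mv_near A n x (mv_mult A (d div gcd d n) (D_term A d n x)) \<and>
       (\<forall>k\<in>{0..n div gcd d n}.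
          mv_near A n (\<sim>\<^bsub>A\<^esub> (mv_mult A k (D_term A d n x)))
            (mv_mult A (n div gcd d n - k) (D_term A d n x))))"


section \<open>Multicomposition\<close>

text \<open>
  A list of pairs \<open>(B, p)\<close> records the algebras \<open>B\<close> obtained so far from \<open>A\<close>
  together with the composite quotient maps \<open>p\<close> from \<open>A\<close> to \<open>B\<close>.
\<close>

definition J1_step :: "nat \<Rightarrow> 'a \<Rightarrow> 'a mv \<times> ('a \<Rightarrow> 'a) \<Rightarrow> ('a mv \<times> ('a \<Rightarrow> 'a)) list" where
  "J1_step n x = (\<lambda>(B, p).
    let c = mv_pow B (mv_mult B (n + 1) (p x)) 2
    in [(mv_quot_elem B c, mv_proj_elem B c \<circ> p),
        (mv_quot_elem B (\<sim>\<^bsub>B\<^esub> c), mv_proj_elem B (\<sim>\<^bsub>B\<^esub> c) \<circ> p)])"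

definition J1_multicomposition ::
    "nat \<Rightarrow> 'a mv \<Rightarrow> 'a list \<Rightarrow> ('a mv \<times> ('a \<Rightarrow> 'a)) list" where
  "J1_multicomposition n A xs =
    foldl (\<lambda>Ds x. concat (map (J1_step n x) Ds)) [(A, \<lambda>a. a)] xs"

definition mv_product_diagram :: "'a mv \<Rightarrow> ('a mv \<times> ('a \<Rightarrow> 'a)) list \<Rightarrow> bool" where
  "mv_product_diagram A Ds \<longleftrightarrow>
    mv_iso A (mv_prod {..<length Ds} (\<lambda>i. fst (Ds ! i))) (\<lambda>a. \<lambda>i\<in>{..<length Ds}. snd (Ds ! i) a)"

end

theory Submission
  imports Defs
begin

text \<open>
  The proof transfers identities from the chains \<open>S_omega_alg m\<close>, \<open>m\<close> dividing \<open>n\<close>, to all algebras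
  of the Komori variety. Two families of terms take only the values \<open>0\<close> and \<open>1\<close> on these chains:
  \<open>J1 n A x\<close>, the square of \<open>(n + 1) x\<close>, which is \<open>0\<close> iff \<open>x\<close> is infinitesimal, and the defect
  \<open>Fin_defect n A d x\<close>, the sum of \<open>J1\<close> over all errors in the formula \<open>Fin\<close>, which is \<open>0\<close> iff \<open>x\<close> has
  the fraction \<open>d / n\<close> of the unit as its standard part (\<open>lex_chain_J1\<close>, \<open>lex_chain_Fin_defect\<close>). All
  relations between such values hold on the chains by a case distinction, so they are identities of the
  variety.

  An algebra \<open>A\<close> of the variety is local iff it is nontrivial and \<open>J1\<close> takes no values but \<open>0\<close> and \<open>1\<close>
  on it (\<open>local_iff_J1\<close>). The elements that satisfy some \<open>Fin\<close> formula form a subalgebra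
  (\<open>Fin_subalgebra\<close>), on which \<open>J1\<close> is \<open>0\<close> or \<open>1\<close> (\<open>J1_of_Fin\<close>). So a nontrivial quotient of \<open>A\<close> in
  which every generator satisfies a \<open>Fin\<close> formula is local. Conversely, for every \<open>x\<close> the complements
  of the defects add up to \<open>1\<close>; in a local algebra the defects are \<open>0\<close> or \<open>1\<close>, so one of them is \<open>0\<close>
  (\<open>Fin_exists\<close>). This is the equivalence in (ii).

  A Boolean element \<open>c\<close> of the form \<open>J1 n A z\<close> splits \<open>A\<close> as the product of its quotients by \<open>c\<close> and
  by \<open>\<sim> c\<close> (\<open>boolean_quotients\<close>), which gives the product diagram. The quotients remain finitely
  presentable, because one relation is added (\<open>fp_quot_boolean\<close>). For (i), the
  multicomposition is applied to the defects of finitely many generators, and the trivial factors are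
  dropped.
\<close>

section \<open>The terms that decide the formulae Fin\<close>

text \<open>
  In \<open>S_omega_alg m\<close> with \<open>m \<le> n\<close> this term takes only the values \<open>0\<close> and \<open>1\<close>, and it is \<open>0\<close>
  exactly on the infinitesimals: a non-infinitesimal is at least about \<open>1 / m\<close> of the unit, so its
  \<open>(n + 1)\<close>-fold sum reaches the unit, while a sum of infinitesimals is infinitesimal and squares to \<open>0\<close>.
\<close>
definition J1 :: "nat \<Rightarrow> 'a mv \<Rightarrow> 'a \<Rightarrow> 'a" where
  "J1 n A x = mv_pow A (mv_mult A (n + 1) x) 2"

text \<open>
  The elements that the formula \<open>Fin\<close> requires to be infinitesimal: each conjunct \<open>z \<equiv> w\<close> says
  that \<open>J1\<close> vanishes on the distance of \<open>z\<close> and \<open>w\<close>.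
\<close>
definition Fin_errors :: "nat \<Rightarrow> 'a mv \<Rightarrow> nat \<Rightarrow> 'a \<Rightarrow> 'a list" where
  "Fin_errors n A d x =
    (if d = 0 then [x]
     else mv_dist A x (mv_mult A (d div gcd d n) (D_term A d n x)) #
       map (\<lambda>k. mv_dist A (\<sim>\<^bsub>A\<^esub> (mv_mult A k (D_term A d n x)))
                 (mv_mult A (n div gcd d n - k) (D_term A d n x))) [0..<n div gcd d n + 1])"

text \<open>
  Turns the conjunction \<open>Fin\<close> into one equation, since a sum is \<open>0\<close> only if its summands are. On
  the generating chains the defect is moreover Boolean, which makes it usable for splitting.
\<close>
definition Fin_defect :: "nat \<Rightarrow> 'a mv \<Rightarrow> nat \<Rightarrow> 'a \<Rightarrow> 'a" where
  "Fin_defect n A d x = foldr (\<lambda>e y. J1 n A e \<oplus>\<^bsub>A\<^esub> y) (Fin_errors n A d x) \<zero>\<^bsub>A\<^esub>"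

section \<open>Naturality of the derived operations\<close>

text \<open>
  No carriers are mentioned, so the notion applies both to evaluation of terms and to the maps
  between a chain and its rank.
\<close>
definition preserves_ops :: "'a mv \<Rightarrow> 'b mv \<Rightarrow> ('a \<Rightarrow> 'b) \<Rightarrow> bool" where
  "preserves_ops A B f \<longleftrightarrow> f \<zero>\<^bsub>A\<^esub> = \<zero>\<^bsub>B\<^esub> \<and> (\<forall>x. f (\<sim>\<^bsub>A\<^esub> x) = \<sim>\<^bsub>B\<^esub> (f x)) \<and>
    (\<forall>x y. f (x \<oplus>\<^bsub>A\<^esub> y) = f x \<oplus>\<^bsub>B\<^esub> f y)"

context
  fixes A :: "'a mv" and B :: "'b mv" and f
  assumes f: "preserves_ops A B f"
begin

lemma preserves_basic:
  "f \<zero>\<^bsub>A\<^esub> = \<zero>\<^bsub>B\<^esub>" "f (\<sim>\<^bsub>A\<^esub> x) = \<sim>\<^bsub>B\<^esub> (f x)" "f (x \<oplus>\<^bsub>A\<^esub> y) = f x \<oplus>\<^bsub>B\<^esub> f y"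
  using f by (auto simp: preserves_ops_def)

lemma preserves_one: "f \<one>\<^bsub>A\<^esub> = \<one>\<^bsub>B\<^esub>"
  and preserves_times: "f (x \<odot>\<^bsub>A\<^esub> y) = f x \<odot>\<^bsub>B\<^esub> f y"
  and preserves_dist: "f (mv_dist A x y) = mv_dist B (f x) (f y)"
  by (simp_all add: mv_one_def mv_times_def mv_dist_def preserves_basic)

lemma preserves_mult: "f (mv_mult A k x) = mv_mult B k (f x)"
  by (induction k) (simp_all add: mv_mult_def preserves_basic)

lemma preserves_pow: "f (mv_pow A x k) = mv_pow B (f x) k"
  by (induction k) (simp_all add: mv_pow_def preserves_one preserves_times)

lemma preserves_seq_sum: "f (mv_seq_sum A a b i) = mv_seq_sum B (f \<circ> a) (f \<circ> b) i"
proof -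
  have "f (foldr (\<lambda>j y. (a (i - j) \<odot>\<^bsub>A\<^esub> b j) \<oplus>\<^bsub>A\<^esub> y) js (b i)) =
      foldr (\<lambda>j y. (f (a (i - j)) \<odot>\<^bsub>B\<^esub> f (b j)) \<oplus>\<^bsub>B\<^esub> y) js (f (b i))" for js
    by (induction js) (simp_all add: preserves_basic preserves_times)
  then show ?thesis
    by (simp add: mv_seq_sum_def preserves_basic)
qed

lemma preserves_seq_mult: "f \<circ> mv_seq_mult A k x = mv_seq_mult B k (f x)"
proof (induction k)
  case (Suc k)
  have "f \<circ> mv_seq_single A x = mv_seq_single B (f x)"
    by (auto simp: mv_seq_single_def preserves_basic)
  then show ?case
    using Suc by (auto simp: mv_seq_mult_def preserves_seq_sum comp_def)
qed (auto simp: mv_seq_mult_def preserves_basic)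

lemma preserves_D_term: "f (D_term A d n x) = D_term B d n (f x)"
  using preserves_seq_mult[THEN fun_cong]
  by (simp add: D_term_def split: prod.splits)

lemma preserves_J1: "f (J1 n A x) = J1 n B (f x)"
  by (simp add: J1_def preserves_pow preserves_mult)

lemma preserves_Fin_errors: "map f (Fin_errors n A d x) = Fin_errors n B d (f x)"
  by (simp add: Fin_errors_def preserves_dist preserves_mult preserves_basic preserves_D_term)

lemma preserves_Fin_defect: "f (Fin_defect n A d x) = Fin_defect n B d (f x)"
proof -
  have "f (foldr (\<lambda>e y. J1 n A e \<oplus>\<^bsub>A\<^esub> y) es \<zero>\<^bsub>A\<^esub>) = foldr (\<lambda>e y. J1 n B e \<oplus>\<^bsub>B\<^esub> y) (map f es) \<zero>\<^bsub>B\<^esub>" for es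
    by (induction es) (simp_all add: preserves_basic preserves_J1)
  then show ?thesis
    by (simp add: Fin_defect_def preserves_Fin_errors)
qed

end

lemmas preserves =
  preserves_basic preserves_one preserves_times preserves_dist preserves_mult preserves_pow
  preserves_D_term preserves_J1 preserves_Fin_defect

text \<open>
  Applying a derived operation such as \<open>D_term\<close> in the algebra of terms yields the MV-term that
  defines it, so identities can be written with the same names as the operations.
\<close>
abbreviation TM :: "mv_term mv" where "TM \<equiv> mv_term_algebra 0"

lemma TM_ops: "t \<oplus>\<^bsub>mv_term_algebra k\<^esub> s = Plus t s" "\<sim>\<^bsub>mv_term_algebra k\<^esub> t = Neg t"
    "\<zero>\<^bsub>mv_term_algebra k\<^esub> = Zero"
  by (simp_all add: mv_term_algebra_def)

lemma eval_preserves: "preserves_ops TM A (mv_eval A v)"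
  by (simp add: preserves_ops_def TM_ops)

lemmas eval_TM = preserves[OF eval_preserves]

definition mv_closed :: "'a mv \<Rightarrow> bool" where
  "mv_closed A \<longleftrightarrow> mv_subalgebra A (carr A)"

lemma closedD:
  assumes "mv_closed A"
  shows "\<zero>\<^bsub>A\<^esub> \<in> carr A" "x \<in> carr A \<Longrightarrow> \<sim>\<^bsub>A\<^esub> x \<in> carr A"
    "x \<in> carr A \<Longrightarrow> y \<in> carr A \<Longrightarrow> x \<oplus>\<^bsub>A\<^esub> y \<in> carr A"
  using assms by (auto simp: mv_closed_def mv_subalgebra_def)

lemma eval_closed:
  assumes "mv_closed A" "\<And>i. i \<in> mv_vars t \<Longrightarrow> v i \<in> carr A"
  shows "mv_eval A v t \<in> carr A"
  using assms(2) by (induction t) (auto intro: closedD[OF assms(1)])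

text \<open>
  Every derived operation is the evaluation of its own term, so closure and compatibility with
  homomorphisms follow from the corresponding facts on evaluation.
\<close>
lemma closed_ops:
  assumes A: "mv_closed A" and x: "x \<in> carr A"
  shows "mv_mult A k x \<in> carr A" "D_term A d n x \<in> carr A" "J1 n A x \<in> carr A"
    "Fin_defect n A d x \<in> carr A"
proof -
  have "mv_eval A (\<lambda>_. x) t \<in> carr A" for t
    using eval_closed[OF A, of t "\<lambda>_. x"] x by simp
  from this[of "mv_mult TM k (Var 0)"] this[of "D_term TM d n (Var 0)"]
    this[of "J1 n TM (Var 0)"] this[of "Fin_defect n TM d (Var 0)"]
  show "mv_mult A k x \<in> carr A" "D_term A d n x \<in> carr A" "J1 n A x \<in> carr A"
    "Fin_defect n A d x \<in> carr A"
    by (simp_all add: eval_TM)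
qed

lemma Fin_errors_closed:
  assumes A: "mv_closed A" and x: "x \<in> carr A"
  shows "set (Fin_errors n A d x) \<subseteq> carr A"
proof -
  have "Fin_errors n A d x = map (mv_eval A (\<lambda>_. x)) (Fin_errors n TM d (Var 0))"
    by (simp add: preserves_Fin_errors[OF eval_preserves])
  then show ?thesis
    using eval_closed[OF A, of _ "\<lambda>_. x"] x by auto
qed

lemma hom_eval:
  assumes "mv_closed A" "mv_hom A B f" "\<And>i. i \<in> mv_vars t \<Longrightarrow> v i \<in> carr A"
  shows "f (mv_eval A v t) = mv_eval B (f \<circ> v) t"
  using assms(3)
proof (induction t)
  case (Plus s t)
  then show ?case
    using assms(2) eval_closed[OF assms(1), of _ v] by (auto simp: mv_hom_def)
next
  case (Neg t)
  then show ?case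
    using assms(2) eval_closed[OF assms(1), of _ v] by (auto simp: mv_hom_def)
qed (use assms(2) in \<open>auto simp: mv_hom_def\<close>)

lemma hom_ops:
  assumes A: "mv_closed A" and f: "mv_hom A B f" and x: "x \<in> carr A"
  shows "f (J1 n A x) = J1 n B (f x)" "f (Fin_defect n A d x) = Fin_defect n B d (f x)"
proof -
  have "f (mv_eval A (\<lambda>_. x) t) = mv_eval B (\<lambda>_. f x) t" for t
    using hom_eval[OF A f, of t "\<lambda>_. x"] x by (simp add: comp_def)
  from this[of "J1 n TM (Var 0)"] this[of "Fin_defect n TM d (Var 0)"]
  show "f (J1 n A x) = J1 n B (f x)" "f (Fin_defect n A d x) = Fin_defect n B d (f x)"
    by (simp_all add: eval_TM)
qed

section \<open>The numbers xi and chi and the integer chains\<close>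

lemma int_chain_ops:
  "x \<oplus>\<^bsub>S_alg m\<^esub> y = min (x + y) (int m)" "\<sim>\<^bsub>S_alg m\<^esub> x = int m - x" "\<zero>\<^bsub>S_alg m\<^esub> = 0"
  "carr (S_alg m) = {0..int m}" "\<one>\<^bsub>S_alg m\<^esub> = int m"
  by (simp_all add: S_alg_def Gamma_def inf_min mv_one_def)

lemma int_chain_times: "y \<le> int m \<Longrightarrow> x \<le> int m \<Longrightarrow> x \<odot>\<^bsub>S_alg m\<^esub> y = max 0 (x + y - int m)"
  by (simp add: mv_times_def int_chain_ops)

lemma int_chain_mult:
  "0 \<le> x \<Longrightarrow> mv_mult (S_alg m) k x = min (int k * x) (int m)"
  by (induction k) (auto simp: mv_mult_def int_chain_ops algebra_simps min_def)

lemma int_chain_dist: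
  "x \<in> carr (S_alg m) \<Longrightarrow> y \<in> carr (S_alg m) \<Longrightarrow> mv_dist (S_alg m) x y = \<bar>x - y\<bar>"
  by (auto simp: mv_dist_def int_chain_ops int_chain_times)

text \<open>
  The multiples of the sequence \<open>(a, 0, 0, \<dots>)\<close> are the good sequences of the integers \<open>k * a\<close>: the
  component at \<open>i + 1\<close> is the part of \<open>k * a\<close> between \<open>i\<close> and \<open>i + 1\<close> units. Only the last summand of
  the convolution involves the nonzero first entry, which gives the recursion used in the step.
\<close>
lemma int_chain_seq_mult:
  assumes a: "0 \<le> a" "a \<le> int m"
  shows "mv_seq_mult (S_alg m) k a (Suc i) = min (int m) (max 0 (int k * a - int i * int m))"
proof (induction k arbitrary: i)
  case 0
  show ?case by (simp add: mv_seq_mult_def int_chain_ops)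
next
  case (Suc k)
  define b where "b = mv_seq_mult (S_alg m) k a"
  have b: "b (Suc i) = min (int m) (max 0 (int k * a - int i * int m))" for i
    by (simp add: b_def Suc)
  have sum: "mv_seq_mult (S_alg m) (Suc k) a i = mv_seq_sum (S_alg m) (mv_seq_single (S_alg m) a) b i" for i
    by (simp add: mv_seq_mult_def b_def)
  show ?case
  proof (cases i)
    case 0
    then show ?thesis
      using a by (auto simp: sum mv_seq_sum_def mv_seq_single_def b[of 0, simplified] int_chain_ops algebra_simps min_def max_def)
  next
    case (Suc i')
    let ?f = "\<lambda>j y. (mv_seq_single (S_alg m) a (Suc i - j) \<odot>\<^bsub>S_alg m\<^esub> b j) \<oplus>\<^bsub>S_alg m\<^esub> y"
    \<comment> \<open>the summands before the last are \<open>0 \<odot> b j\<close>, hence \<open>0\<close>\<close>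
    have skip: "foldr ?f js y = y" if "\<forall>j\<in>set js. 0 < j \<and> j < i" "0 \<le> y" "y \<le> int m" for js y
      using that
    proof (induction js)
      case (Cons j js)
      then obtain j' where "j = Suc j'" by (auto simp: gr0_conv_Suc)
      then show ?case
        using Cons by (auto simp: mv_seq_single_def int_chain_ops int_chain_times b)
    qed simp
    define y where "y = (a \<odot>\<^bsub>S_alg m\<^esub> b i) \<oplus>\<^bsub>S_alg m\<^esub> b (Suc i)"
    have y: "y = min (max 0 (a + b i - int m) + b (Suc i)) (int m)"
      using a by (simp add: y_def Suc b int_chain_times) (simp add: int_chain_ops)
    have y01: "0 \<le> y" "y \<le> int m"
      by (auto simp: y b)
    have "[1..<Suc i] = [1..<i] @ [i]"
      by (simp add: Suc)
    then have "mv_seq_mult (S_alg m) (Suc k) a (Suc i) = \<zero>\<^bsub>S_alg m\<^esub> \<oplus>\<^bsub>S_alg m\<^esub> foldr ?f [1..<i] y"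
      by (simp add: sum mv_seq_sum_def Suc mv_seq_single_def y_def del: upt_Suc)
    also have "\<dots> = y"
      using y01 by (subst skip) (auto simp: int_chain_ops)
    also have "\<dots> = min (int m) (max 0 (int (Suc k) * a - int (Suc i') * int m))"
      using a unfolding y Suc b by (simp add: algebra_simps) (smt (verit))
    finally show ?thesis
      by (simp add: Suc)
  qed
qed

text \<open>
  After division by the gcd this is the equation \<open>\<xi> d' = \<chi> n' + 1\<close> with \<open>d'\<close> and \<open>n'\<close> coprime, so
  \<open>\<xi>\<close> is the inverse of \<open>d'\<close> modulo \<open>n'\<close>. The bounds allow both \<open>0\<close> and \<open>n'\<close> as residues; \<open>\<xi> = 0\<close> is
  excluded by the equation, and this makes the description by \<open>THE\<close> well defined.
\<close>
lemma xi_chi: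
  assumes d: "0 < d" "d \<le> n" and xc: "xi_chi d n = (\<xi>, \<chi>)"
  shows "int (gcd d n) = int \<xi> * int d - int \<chi> * int n"
proof -
  define D where "D = gcd d n"
  define d' where "d' = d div D"
  define n' where "n' = n div D"
  have D: "0 < D" and dD: "d = d' * D" and nD: "n = n' * D"
    using d by (simp_all add: D_def d'_def n'_def)
  have d': "0 < d'" "d' \<le> n'"
    using d D by (auto simp: dD nD intro: gr0I)
  have cop: "coprime d' n'"
    unfolding d'_def n'_def D_def using d by (intro div_gcd_coprime) auto
  let ?P = "\<lambda>\<xi> \<chi>. \<xi> \<le> n' \<and> \<chi> \<le> d' \<and> int D = int \<xi> * int d - int \<chi> * int n"
  have eq: "int D = int \<xi> * int d - int \<chi> * int n \<longleftrightarrow> \<xi> * d' = \<chi> * n' + 1" for \<xi> \<chi>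
  proof -
    have "int D = int \<xi> * int d - int \<chi> * int n \<longleftrightarrow> int (\<chi> * n + D) = int (\<xi> * d)"
      by (auto simp: algebra_simps)
    also have "\<dots> \<longleftrightarrow> (\<chi> * n' + 1) * D = (\<xi> * d') * D"
      by (simp only: of_nat_eq_iff) (simp add: dD nD algebra_simps)
    also have "\<dots> \<longleftrightarrow> \<chi> * n' + 1 = \<xi> * d'"
      using D by (simp only: mult_cancel2) simp
    finally show ?thesis
      by (auto simp: eq_commute)
  qed
  have ex: "\<exists>\<xi> \<chi>. ?P \<xi> \<chi>"
  proof (cases "n' = 1")
    case True
    then have "?P 1 0" using d' eq[of 1 0] by simp
    then show ?thesis by blast
  next
    case False
    obtain x y where xy: "d' * x = n' * y + 1"
      using bezout_nat[of d' n'] cop d' by (auto simp: coprime_iff_gcd_eq_1)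
    define q where "q = x div n'"
    define x' where "x' = x mod n'"
    have x: "x = n' * q + x'" "x' < n'"
      using d' by (auto simp: q_def x'_def)
    have e: "d' * x' + n' * (q * d') = n' * y + 1"
      using xy by (simp add: x(1) algebra_simps)
    have "q * d' \<le> y"
    proof (rule ccontr)
      assume "\<not> q * d' \<le> y"
      then obtain z where "q * d' = y + Suc z"
        by (metis less_iff_Suc_add not_le add_Suc_right)
      then show False
        using e False d' by (auto simp: algebra_simps)
    qed
    then obtain y' where "y = q * d' + y'"
      by (metis le_Suc_ex)
    with e have e': "x' * d' = y' * n' + 1"
      by (simp add: algebra_simps)
    have "y' * n' < d' * n'"
      using e' x(2) d' by (metis add_lessD1 less_add_one mult.commute mult_less_mono1 order.strict_trans)
    then have "?P x' y'"
      using x(2) e' by (auto simp: eq)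
    then show ?thesis by blast
  qed
  have uniq: "\<xi>1 = \<xi>2 \<and> \<chi>1 = \<chi>2" if "?P \<xi>1 \<chi>1" "?P \<xi>2 \<chi>2" "\<xi>1 \<le> \<xi>2" for \<xi>1 \<chi>1 \<xi>2 \<chi>2
  proof -
    have e: "\<xi>1 * d' = \<chi>1 * n' + 1" "\<xi>2 * d' = \<chi>2 * n' + 1"
      using that(1,2) eq[of \<xi>1 \<chi>1] eq[of \<xi>2 \<chi>2] by blast+
    obtain k where k: "\<xi>2 = \<xi>1 + k"
      using \<open>\<xi>1 \<le> \<xi>2\<close> le_Suc_ex by blast
    have "\<xi>1 \<noteq> 0"
      using e(1) by (intro notI) simp
    then have "k < n'"
      using that(2) k by auto
    have "\<chi>1 * n' + k * d' = \<chi>2 * n'"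
      using e by (simp add: k algebra_simps)
    then have "n' dvd k * d'"
      by (metis dvd_add_right_iff dvd_triv_right)
    then have "n' dvd k"
      using cop by (simp add: coprime_commute coprime_dvd_mult_left_iff)
    then have "k = 0"
      using \<open>k < n'\<close> by (auto dest: dvd_imp_le)
    then show ?thesis
      using e d' k by auto
  qed
  have uniq': "\<xi>1 = \<xi>2 \<and> \<chi>1 = \<chi>2" if "?P \<xi>1 \<chi>1" "?P \<xi>2 \<chi>2" for \<xi>1 \<chi>1 \<xi>2 \<chi>2
    using uniq[OF that] uniq[OF that(2,1)] by linarith
  have "\<exists>!p. case p of (\<xi>, \<chi>) \<Rightarrow> ?P \<xi> \<chi>"
  proof -
    obtain \<xi>0 \<chi>0 where 0: "?P \<xi>0 \<chi>0" using ex by blast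
    show ?thesis
    proof (rule ex1I)
      show "case (\<xi>0, \<chi>0) of (\<xi>, \<chi>) \<Rightarrow> ?P \<xi> \<chi>"
        using 0 by simp
      fix p assume "case p of (\<xi>, \<chi>) \<Rightarrow> ?P \<xi> \<chi>"
      then have "?P (fst p) (snd p)"
        by (simp add: case_prod_beta)
      from uniq'[OF this 0] show "p = (\<xi>0, \<chi>0)"
        by (simp add: prod_eq_iff)
    qed
  qed
  from theI'[OF this] show ?thesis
    using xc unfolding xi_chi_def D_def n'_def d'_def by (auto split: prod.splits)
qed

text \<open>
  For \<open>x\<close> at the fraction \<open>d / n\<close> of the unit, \<open>\<xi> x - \<chi> m\<close> is the fraction \<open>(\<xi> d - \<chi> n) / n\<close>,
  that is \<open>gcd d n / n\<close>, and this lies between \<open>0\<close> and the unit, so that truncation has no effect.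
\<close>
lemma int_chain_D_term:
  assumes d: "0 < d" "d \<le> n" and x: "int n * x = int d * int m" and m: "0 < m"
  shows "int n * D_term (S_alg m) d n x = int (gcd d n) * int m"
proof -
  obtain \<xi> \<chi> where xc: "xi_chi d n = (\<xi>, \<chi>)" by fastforce
  have D: "int (gcd d n) = int \<xi> * int d - int \<chi> * int n"
    using xi_chi[OF d xc] .
  have n: "0 < int n" using d by simp
  have "0 \<le> int n * x" "int n * x \<le> int n * int m"
    using d m by (simp_all add: x)
  then have x01: "0 \<le> x" "x \<le> int m"
    using n by (simp_all add: zero_le_mult_iff)
  define y where "y = int \<xi> * x - int \<chi> * int m"
  have y: "int n * y = int (gcd d n) * int m"
    using x by (simp add: y_def D algebra_simps)
  have "gcd d n \<le> n" using d by (simp add: gcd_le2_nat)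
  then have "0 \<le> int n * y" "int n * y \<le> int n * int m"
    using m by (simp_all add: y)
  then have "0 \<le> y" "y \<le> int m"
    using n by (simp_all add: zero_le_mult_iff)
  moreover have "D_term (S_alg m) d n x = min (int m) (max 0 y)"
    using int_chain_seq_mult[OF x01, of \<xi> \<chi>] by (simp add: D_term_def xc y_def)
  ultimately show ?thesis
    using y by simp
qed

lemma int_chain_closed: "mv_closed (S_alg m)"
  by (auto simp: mv_closed_def mv_subalgebra_def int_chain_ops)

text \<open>
  Without infinitesimals, \<open>Fin\<close> says that \<open>x\<close> is the fraction \<open>d / n\<close> of the unit. For the direction
  from left to right, let \<open>y\<close> be the value of \<open>D_term\<close>: the conjunct \<open>k = 0\<close> makes \<open>n / gcd d n\<close>
  copies of \<open>y\<close> reach the unit, so \<open>y > 0\<close>, and then the conjunct \<open>k = 1\<close> cannot be truncated and forces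
  \<open>y\<close> to be the fraction \<open>gcd d n / n\<close>. The formula for \<open>D_term\<close> is needed only for the converse.
\<close>
lemma int_chain_Fin_errors:
  assumes m: "0 < m" and n: "0 < n" and d: "d \<le> n" and x: "x \<in> carr (S_alg m)"
  shows "(\<forall>e\<in>set (Fin_errors n (S_alg m) d x). e = 0) \<longleftrightarrow> int n * x = int d * int m"
proof (cases "d = 0")
  case True
  then show ?thesis using n by (simp add: Fin_errors_def)
next
  case False
  define D where "D = gcd d n"
  define d' where "d' = d div D"
  define n' where "n' = n div D"
  define y where "y = D_term (S_alg m) d n x"
  have D: "0 < D" and dD: "d = d' * D" and nD: "n = n' * D"
    using False by (simp_all add: D_def d'_def n'_def)
  have d': "0 < d'" "d' \<le> n'" "1 \<le> n'"
    using d False D by (auto simp: dD nD intro: gr0I)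
  have y01: "0 \<le> y" "y \<le> int m"
    using closed_ops(2)[OF int_chain_closed x] by (auto simp: y_def int_chain_ops)
  have mult01: "mv_mult (S_alg m) k y \<in> carr (S_alg m)" for k
    using closed_ops(1)[OF int_chain_closed] y01 by (auto simp: int_chain_ops)
  have neg01: "\<sim>\<^bsub>S_alg m\<^esub> (mv_mult (S_alg m) k y) \<in> carr (S_alg m)" for k
    using closedD(2)[OF int_chain_closed mult01] .
  have "(\<forall>e\<in>set (Fin_errors n (S_alg m) d x). e = 0) \<longleftrightarrow>
      x = mv_mult (S_alg m) d' y \<and>
      (\<forall>k\<le>n'. \<sim>\<^bsub>S_alg m\<^esub> (mv_mult (S_alg m) k y) = mv_mult (S_alg m) (n' - k) y)"
    using False by (auto simp: Fin_errors_def int_chain_dist[OF x mult01] int_chain_dist[OF neg01 mult01]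
        simp flip: y_def D_def d'_def n'_def simp del: upt_Suc)
  also have "\<dots> \<longleftrightarrow> x = min (int d' * y) (int m) \<and>
      (\<forall>k\<le>n'. int m - min (int k * y) (int m) = min (int (n' - k) * y) (int m))" (is "_ \<longleftrightarrow> ?R")
    using y01 by (simp add: int_chain_mult) (simp add: int_chain_ops)
  also have "\<dots> \<longleftrightarrow> int n * x = int d * int m"
  proof
    \<comment> \<open>the conjuncts \<open>k = 0\<close> and \<open>k = 1\<close> determine \<open>y\<close>\<close>
    assume R: ?R
    have "int m \<le> int n' * y"
      using R d' y01 m by (auto dest!: spec[of _ 0] simp: min_def split: if_splits)
    then have "0 < y"
      using m y01 by (cases "y = 0") auto
    moreover have "int m - min y (int m) = min (int n' * y - y) (int m)"
      using R[THEN conjunct2, rule_format, of 1] d' by (simp add: of_nat_diff algebra_simps)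
    ultimately have "int m = int n' * y"
      using y01 by (auto simp: min_def split: if_splits)
    moreover have "int d' * y \<le> int n' * y"
      using d' y01 by (simp add: mult_right_mono)
    ultimately show "int n * x = int d * int m"
      using R by (simp add: dD nD)
  next
    assume e: "int n * x = int d * int m"
    have "int n * y = int D * int m"
      using int_chain_D_term[OF _ d e m] False by (simp add: y_def D_def)
    then have my: "int m = int n' * y"
      using D by (simp add: nD algebra_simps)
    have "int d' * y \<le> int n' * y"
      using d' y01 by (simp add: mult_right_mono)
    moreover have "x = int d' * y"
      using e D d' by (simp add: dD nD my)
    moreover have "int k * y \<le> int n' * y" if "k \<le> n'" for k
      using that y01 by (simp add: mult_right_mono)
    moreover have "int (n' - k) * y = int n' * y - int k * y" if "k \<le> n'" for k
      using that by (simp add: of_nat_diff algebra_simps)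
    moreover have "0 \<le> int k * y" for k
      using y01 by simp
    ultimately show ?R
      by (simp add: my min_def)
  qed
  finally show ?thesis .
qed

section \<open>The lexicographic chains\<close>

text \<open>
  The first projection and the inclusion of the first coordinate are homomorphisms between
  \<open>S_omega_alg m\<close> and \<open>S_alg m\<close>. The projection reduces questions modulo infinitesimals to integers;
  the inclusion shows that the identities of \<open>S_omega_alg m\<close> already hold in \<open>S_alg m\<close>.
\<close>

lemma lex_chain_ops:
  "x \<oplus>\<^bsub>S_omega_alg m\<^esub> y = min (x + y) (int m, 0)" "\<sim>\<^bsub>S_omega_alg m\<^esub> x = (int m, 0) - x"
  "\<zero>\<^bsub>S_omega_alg m\<^esub> = (0, 0)" "carr (S_omega_alg m) = {(0, 0)..(int m, 0)}"
  "\<one>\<^bsub>S_omega_alg m\<^esub> = (int m, 0)"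
  by (simp_all add: S_omega_alg_def Gamma_def inf_prod_def inf_min mv_one_def zero_prod_def)

lemma fst_preserves: "preserves_ops (S_omega_alg m) (S_alg m) fst"
  by (auto simp: preserves_ops_def lex_chain_ops int_chain_ops min_def less_eq_prod_def)

lemma embed_preserves: "preserves_ops (S_alg m) (S_omega_alg m) (\<lambda>a. (a, 0))"
  by (auto simp: preserves_ops_def lex_chain_ops int_chain_ops min_def less_eq_prod_def)

lemma preserves_eval:
  assumes "preserves_ops A B f" shows "f (mv_eval A v t) = mv_eval B (f \<circ> v) t"
  by (induction t) (simp_all add: preserves_basic[OF assms])

lemma lex_chain_carr:
  "(a, b) \<in> carr (S_omega_alg m) \<longleftrightarrow> 0 \<le> a \<and> a \<le> int m \<and> (a = 0 \<longrightarrow> 0 \<le> b) \<and> (a = int m \<longrightarrow> b \<le> 0)"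
  by (auto simp: lex_chain_ops less_eq_prod_def)

lemma lex_chain_closed: "mv_closed (S_omega_alg m)"
  unfolding mv_closed_def mv_subalgebra_def
  by (auto simp: lex_chain_carr; auto simp: lex_chain_ops less_eq_prod_def min_def)

lemma lex_chain_J1:
  assumes m: "0 < m" "m \<le> n" and x: "x \<in> carr (S_omega_alg m)"
  shows "J1 n (S_omega_alg m) x = (if fst x = 0 then (0, 0) else (int m, 0))"
proof -
  obtain a b where ab: "x = (a, b)" by force
  have mult: "mv_mult (S_omega_alg m) k x = min (int k * a, int k * b) (int m, 0)" for k
  proof (induction k)
    case 0
    then show ?case using m by (simp add: mv_mult_def lex_chain_ops less_eq_prod_def min_def)
  next
    case (Suc k)
    then show ?case using x
      by (auto simp: ab mv_mult_def lex_chain_ops less_eq_prod_def min_def algebra_simps)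
  qed
  have "int m < int (Suc n) * a" if "a \<noteq> 0"
  proof -
    have "int (Suc n) * 1 \<le> int (Suc n) * a"
      using that x by (intro mult_left_mono) (auto simp: ab lex_chain_carr)
    moreover have "int m < int (Suc n)" using m by simp
    ultimately show ?thesis by (metis mult_1_right order_less_le_trans)
  qed
  moreover have "mv_pow (S_omega_alg m) (int m, 0) 2 = (int m, 0)"
    using m by (simp add: mv_pow_def mv_times_def eval_nat_numeral lex_chain_ops less_eq_prod_def min_def)
  moreover have "mv_pow (S_omega_alg m) (0, c) 2 = (0, 0)" if "0 \<le> c" for c
    using m that
    by (simp add: mv_pow_def mv_times_def eval_nat_numeral lex_chain_ops less_eq_prod_def min_def zero_prod_def)
  moreover have "mv_mult (S_omega_alg m) (n + 1) x = (if a = 0 then (0, int (n + 1) * b) else (int m, 0))"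
    using m calculation(1) unfolding mult by (cases "a = 0") (auto simp: min_def less_eq_prod_def)
  moreover have "a = 0 \<Longrightarrow> 0 \<le> int (n + 1) * b"
    using x by (simp add: ab lex_chain_carr)
  ultimately show ?thesis
    by (auto simp: J1_def ab)
qed

lemma lex_chain_Fin_defect:
  assumes m: "0 < m" "m \<le> n" and d: "d \<le> n" and x: "x \<in> carr (S_omega_alg m)"
  shows "Fin_defect n (S_omega_alg m) d x =
    (if int n * fst x = int d * int m then (0, 0) else (int m, 0))"
proof -
  let ?A = "S_omega_alg m"
  have carr: "fst x \<in> carr (S_alg m)"
    using x by (cases x) (auto simp: lex_chain_carr int_chain_ops)
  have sum: "foldr (\<lambda>e y. J1 n ?A e \<oplus>\<^bsub>?A\<^esub> y) es \<zero>\<^bsub>?A\<^esub> = (if \<forall>e\<in>set es. fst e = 0 then (0,0) else (int m, 0))"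
    if "set es \<subseteq> carr ?A" for es
    using that m by (induction es) (simp_all add: lex_chain_J1, auto simp: lex_chain_ops min_def less_eq_prod_def)
  have errs: "set (Fin_errors n ?A d x) \<subseteq> carr ?A"
    by (rule Fin_errors_closed[OF lex_chain_closed x])
  have "(\<forall>e\<in>set (Fin_errors n ?A d x). fst e = 0) \<longleftrightarrow>
      (\<forall>e\<in>set (map fst (Fin_errors n ?A d x)). e = 0)"
    by simp
  also have "\<dots> \<longleftrightarrow> int n * fst x = int d * int m"
    unfolding preserves_Fin_errors[OF fst_preserves]
    using m d carr by (intro int_chain_Fin_errors) auto
  finally show ?thesis
    by (simp add: Fin_defect_def sum[OF errs])
qed

section \<open>Ideals generated by Boolean elements\<close>

context mv_algebra
begin

lemma mv_closed: "mv_closed A"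
  by (auto simp: mv_closed_def mv_subalgebra_def zero_closed neg_closed plus_closed)

lemma one_closed: "\<one> \<in> carr A"
  by (simp add: mv_one_def neg_closed zero_closed)

lemma neg_one: "\<sim> \<one> = \<zero>"
  by (simp add: mv_one_def neg_neg zero_closed)

lemma zero_plus: "x \<in> carr A \<Longrightarrow> \<zero> \<oplus> x = x"
  by (metis plus_comm plus_zero zero_closed)

lemma plus_one: "x \<in> carr A \<Longrightarrow> x \<oplus> \<one> = \<one>" "x \<in> carr A \<Longrightarrow> \<one> \<oplus> x = \<one>"
  by (metis mv_one_def plus_neg_zero, metis mv_one_def one_closed plus_comm plus_neg_zero)

lemma neg_plus_self:
  assumes x: "x \<in> carr A" shows "\<sim> x \<oplus> x = \<one>" "x \<oplus> \<sim> x = \<one>"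
proof -
  have "\<sim> (\<sim> x \<oplus> \<one>) \<oplus> \<one> = \<sim> (\<sim> \<one> \<oplus> x) \<oplus> x"
    using x one_closed by (rule lukasiewicz)
  then show 1: "\<sim> x \<oplus> x = \<one>"
    using x by (simp add: plus_one neg_closed zero_plus neg_one zero_closed)
  then show "x \<oplus> \<sim> x = \<one>"
    using x by (simp add: plus_comm neg_closed)
qed

lemma le_iff_plus:
  assumes x: "x \<in> carr A" and y: "y \<in> carr A"
  shows "mv_le A x y \<longleftrightarrow> (\<exists>z\<in>carr A. y = x \<oplus> z)"
proof
  assume "mv_le A x y"
  then have "\<sim> (\<sim> y \<oplus> x) \<oplus> x = y"
    using lukasiewicz[OF x y] y by (simp add: mv_le_def neg_one zero_plus)
  then show "\<exists>z\<in>carr A. y = x \<oplus> z"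
    using x y by (metis neg_closed plus_closed plus_comm)
next
  assume "\<exists>z\<in>carr A. y = x \<oplus> z"
  then show "mv_le A x y"
    using x by (auto simp: mv_le_def plus_one neg_plus_self neg_closed simp flip: plus_assoc)
qed

lemma plus_eq_zero:
  assumes "x \<in> carr A" "y \<in> carr A"
  shows "x \<oplus> y = \<zero> \<longleftrightarrow> x = \<zero> \<and> y = \<zero>"
proof -
  have *: "x = \<zero>" if "x \<in> carr A" "y \<in> carr A" "x \<oplus> y = \<zero>" for x y
  proof -
    have "\<sim> x \<oplus> (x \<oplus> y) = \<one>"
      using that(1,2) by (simp add: neg_plus_self plus_one neg_closed flip: plus_assoc)
    then have "\<sim> x = \<one>"
      using that by (simp add: plus_zero neg_closed)
    then show ?thesis
      using that(1) by (metis neg_neg neg_one)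
  qed
  then show ?thesis
    using assms *[of y x] by (auto simp: plus_comm plus_zero zero_closed)
qed

lemma mult_boolean:
  assumes "c \<in> carr A" "c \<oplus> c = c" "k \<ge> 1"
  shows "mv_mult A k c = c"
  using assms(3)
proof (induction k rule: dec_induct)
  case base
  then show ?case using assms by (simp add: mv_mult_def plus_zero)
next
  case (step k)
  then show ?case using assms by (simp add: mv_mult_def)
qed

lemma dist_closed: "x \<in> carr A \<Longrightarrow> y \<in> carr A \<Longrightarrow> mv_dist A x y \<in> carr A"
  by (simp add: mv_dist_def mv_times_def neg_closed plus_closed)

lemma le_refl: "x \<in> carr A \<Longrightarrow> mv_le A x x"
  by (simp add: mv_le_def neg_plus_self)

lemma le_trans:
  assumes "x \<in> carr A" "y \<in> carr A" "z \<in> carr A" "mv_le A x y" "mv_le A y z"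
  shows "mv_le A x z"
proof -
  obtain a b where "a \<in> carr A" "b \<in> carr A" "y = x \<oplus> a" "z = y \<oplus> b"
    using assms by (auto simp: le_iff_plus)
  then have "a \<oplus> b \<in> carr A" "z = x \<oplus> (a \<oplus> b)"
    using assms by (auto simp: plus_assoc plus_closed)
  then show ?thesis
    using assms le_iff_plus by blast
qed

lemma le_antisym:
  assumes "x \<in> carr A" "y \<in> carr A" "mv_le A x y" "mv_le A y x"
  shows "x = y"
  using lukasiewicz[OF assms(1,2)] assms by (simp add: mv_le_def neg_one zero_plus)

lemma plus_swap:
  assumes "x \<in> carr A" "y \<in> carr A" "z \<in> carr A" "w \<in> carr A"
  shows "(x \<oplus> y) \<oplus> (z \<oplus> w) = (x \<oplus> z) \<oplus> (y \<oplus> w)"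
  using assms by (metis plus_assoc plus_comm plus_closed)

text \<open>
  For Boolean \<open>c\<close> the elements below \<open>c\<close> are closed under addition, so they already form the ideal
  generated by \<open>c\<close>.
\<close>
lemma le_plus_boolean:
  assumes c: "c \<in> carr A" "c \<oplus> c = c" and x: "x \<in> carr A" and y: "y \<in> carr A"
  shows "mv_le A (x \<oplus> y) c \<longleftrightarrow> mv_le A x c \<and> mv_le A y c"
proof
  assume "mv_le A (x \<oplus> y) c"
  moreover have "mv_le A x (x \<oplus> y)" "mv_le A y (x \<oplus> y)"
    using x y by (auto simp: le_iff_plus plus_closed intro: plus_comm)
  ultimately show "mv_le A x c \<and> mv_le A y c"
    using x y c by (blast intro: le_trans plus_closed)
next
  assume "mv_le A x c \<and> mv_le A y c"
  then obtain z w where zw: "z \<in> carr A" "w \<in> carr A" "c = x \<oplus> z" "c = y \<oplus> w"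
    using c x y by (auto simp: le_iff_plus)
  then have "c = (x \<oplus> y) \<oplus> (z \<oplus> w)"
    using c(2) x y plus_swap[of x z y w] by simp
  then show "mv_le A (x \<oplus> y) c"
    using zw x y c by (auto simp: le_iff_plus plus_closed)
qed

lemma ideal_gen_boolean:
  assumes c: "c \<in> carr A" "c \<oplus> c = c"
  shows "mv_ideal_gen A c = {x \<in> carr A. mv_le A x c}"
proof
  have "mv_ideal A {x \<in> carr A. mv_le A x c}"
    unfolding mv_ideal_def
    using c by (auto simp: le_plus_boolean plus_closed zero_closed le_iff_plus[of \<zero>] zero_plus
        intro: le_trans)
  then show "mv_ideal_gen A c \<subseteq> {x \<in> carr A. mv_le A x c}"
    using c(1) le_refl unfolding mv_ideal_gen_def by blast
  show "{x \<in> carr A. mv_le A x c} \<subseteq> mv_ideal_gen A c"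
    unfolding mv_ideal_gen_def mv_ideal_def by blast
qed

lemma le_plus_iff:
  assumes "x \<in> carr A" "y \<in> carr A" "c \<in> carr A"
  shows "mv_le A (x \<odot> \<sim> y) c \<longleftrightarrow> mv_le A x (y \<oplus> c)"
  using assms by (simp add: mv_le_def mv_times_def neg_neg neg_closed plus_closed plus_assoc)

text \<open>
  A Boolean element is idempotent for addition, so adding it once absorbs everything below it.
  This explicit form of the congruence replaces the distance function in all that follows.
\<close>
lemma ideal_cong_boolean:
  assumes c: "c \<in> carr A" "c \<oplus> c = c"
  shows "mv_ideal_cong A (mv_ideal_gen A c) =
    {(x, y). x \<in> carr A \<and> y \<in> carr A \<and> x \<oplus> c = y \<oplus> c}"
proof -
  have half: "mv_le A x (y \<oplus> c) \<longleftrightarrow> mv_le A (x \<oplus> c) (y \<oplus> c)"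
    if x: "x \<in> carr A" and y: "y \<in> carr A" for x y
  proof
    assume "mv_le A x (y \<oplus> c)"
    then obtain z where z: "z \<in> carr A" "y \<oplus> c = x \<oplus> z"
      using x y c by (auto simp: le_iff_plus plus_closed)
    have "y \<oplus> c = (y \<oplus> c) \<oplus> c"
      using y c by (simp add: plus_assoc)
    also have "\<dots> = (x \<oplus> c) \<oplus> z"
      using x z c by (metis plus_assoc plus_comm)
    finally show "mv_le A (x \<oplus> c) (y \<oplus> c)"
      using x y c z by (auto simp: le_iff_plus plus_closed)
  next
    assume "mv_le A (x \<oplus> c) (y \<oplus> c)"
    moreover have "mv_le A x (x \<oplus> c)"
      using x c by (auto simp: le_iff_plus plus_closed)
    ultimately show "mv_le A x (y \<oplus> c)"
      using x y c by (blast intro: le_trans plus_closed)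
  qed
  have "mv_le A (mv_dist A x y) c \<longleftrightarrow> x \<oplus> c = y \<oplus> c" if x: "x \<in> carr A" and y: "y \<in> carr A" for x y
  proof -
    have "x \<odot> \<sim> y \<in> carr A" "y \<odot> \<sim> x \<in> carr A"
      using x y by (simp_all add: mv_times_def neg_closed plus_closed)
    then have "mv_le A (mv_dist A x y) c \<longleftrightarrow>
        mv_le A (x \<oplus> c) (y \<oplus> c) \<and> mv_le A (y \<oplus> c) (x \<oplus> c)"
      using x y c by (simp add: mv_dist_def le_plus_boolean le_plus_iff half)
    then show ?thesis
      using x y c by (metis le_antisym le_refl plus_closed)
  qed
  then show ?thesis
    by (auto simp: mv_ideal_cong_def ideal_gen_boolean[OF c] dist_closed)
qed

lemma dist_neg:
  assumes "x \<in> carr A" "y \<in> carr A"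
  shows "mv_dist A (\<sim> x) (\<sim> y) = mv_dist A x y"
  using assms by (simp add: mv_dist_def mv_times_def neg_neg neg_closed plus_closed plus_comm)

lemma congruence_boolean:
  assumes c: "c \<in> carr A" "c \<oplus> c = c"
  shows "mv_congruence A (mv_ideal_cong A (mv_ideal_gen A c))" (is "mv_congruence A ?\<theta>")
  unfolding mv_congruence_def
proof (intro conjI allI impI)
  show "equiv (carr A) ?\<theta>"
    unfolding ideal_cong_boolean[OF c]
    by (auto intro!: equivI simp: refl_on_def sym_def trans_def)
  show "(\<sim> x, \<sim> y) \<in> ?\<theta>" if "(x, y) \<in> ?\<theta>" for x y
    using that by (auto simp: mv_ideal_cong_def dist_neg neg_closed)
  fix x y x' y'
  assume xy: "(x, y) \<in> ?\<theta>" "(x', y') \<in> ?\<theta>"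
  then have carr: "x \<in> carr A" "y \<in> carr A" "x' \<in> carr A" "y' \<in> carr A"
    and e: "x \<oplus> c = y \<oplus> c" "x' \<oplus> c = y' \<oplus> c"
    by (auto simp: ideal_cong_boolean[OF c])
  have "(x \<oplus> x') \<oplus> (c \<oplus> c) = (y \<oplus> y') \<oplus> (c \<oplus> c)"
    using carr c e by (metis plus_swap)
  then show "(x \<oplus> x', y \<oplus> y') \<in> ?\<theta>"
    using carr by (simp add: ideal_cong_boolean[OF c] c plus_closed)
qed

end

section \<open>Quotients, kernels and homomorphic images\<close>

lemma hom_surj_closed:
  assumes "mv_closed A" "mv_hom A B f" "f ` carr A = carr B"
  shows "mv_closed B"
proof -
  have "\<zero>\<^bsub>B\<^esub> = f \<zero>\<^bsub>A\<^esub>" "\<And>x. x \<in> carr A \<Longrightarrow> \<sim>\<^bsub>B\<^esub> (f x) = f (\<sim>\<^bsub>A\<^esub> x)"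
    "\<And>x y. x \<in> carr A \<Longrightarrow> y \<in> carr A \<Longrightarrow> f x \<oplus>\<^bsub>B\<^esub> f y = f (x \<oplus>\<^bsub>A\<^esub> y)"
    using assms(2) by (auto simp: mv_hom_def)
  then show ?thesis
    by (auto simp: mv_closed_def mv_subalgebra_def closedD[OF assms(1)] simp flip: assms(3))
qed

lemma proj_class:
  assumes "equiv (carr A) \<theta>" "x \<in> carr A"
  shows "(x, mv_proj \<theta> x) \<in> \<theta>"
  unfolding mv_proj_def using assms by (metis equiv_class_self Image_singleton_iff someI)

lemma proj_eq_iff:
  assumes \<theta>: "equiv (carr A) \<theta>" and x: "x \<in> carr A" and y: "y \<in> carr A"
  shows "mv_proj \<theta> x = mv_proj \<theta> y \<longleftrightarrow> (x, y) \<in> \<theta>"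
proof
  assume "mv_proj \<theta> x = mv_proj \<theta> y"
  with proj_class[OF \<theta> x] proj_class[OF \<theta> y] show "(x, y) \<in> \<theta>"
    using \<theta> by (metis equivE symD transD)
next
  assume "(x, y) \<in> \<theta>"
  then have "\<And>z. (x, z) \<in> \<theta> \<longleftrightarrow> (y, z) \<in> \<theta>"
    using \<theta> by (metis equivE symD transD)
  then show "mv_proj \<theta> x = mv_proj \<theta> y"
    by (simp add: mv_proj_def)
qed

lemma proj_in_carr:
  assumes "equiv (carr A) \<theta>" "x \<in> carr A"
  shows "mv_proj \<theta> x \<in> carr A"
  using proj_class[OF assms] assms(1) by (auto elim: equivE)

lemma quot_hom:
  assumes A: "mv_closed A" and \<theta>: "mv_congruence A \<theta>"
  shows "mv_hom A (mv_quot A \<theta>) (mv_proj \<theta>)" "mv_proj \<theta> ` carr A = carr (mv_quot A \<theta>)"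
proof -
  have eq: "equiv (carr A) \<theta>"
    and cn: "\<And>x y. (x, y) \<in> \<theta> \<Longrightarrow> (\<sim>\<^bsub>A\<^esub> x, \<sim>\<^bsub>A\<^esub> y) \<in> \<theta>"
    and cp: "\<And>x y x' y'. (x, y) \<in> \<theta> \<Longrightarrow> (x', y') \<in> \<theta> \<Longrightarrow> (x \<oplus>\<^bsub>A\<^esub> x', y \<oplus>\<^bsub>A\<^esub> y') \<in> \<theta>"
    using \<theta> unfolding mv_congruence_def by blast+
  note [simp] = closedD[OF A] proj_in_carr[OF eq] proj_eq_iff[OF eq]
  show "mv_hom A (mv_quot A \<theta>) (mv_proj \<theta>)"
    unfolding mv_hom_def mv_quot_def
    using proj_class[OF eq] cn cp by auto
  show "mv_proj \<theta> ` carr A = carr (mv_quot A \<theta>)"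
    by (simp add: mv_quot_def)
qed

lemma cong_gen:
  assumes A: "mv_closed A" and R: "R \<subseteq> carr A \<times> carr A"
  shows "mv_congruence A (mv_cong_gen A R)" "R \<subseteq> mv_cong_gen A R"
    "\<And>\<theta>. mv_congruence A \<theta> \<Longrightarrow> R \<subseteq> \<theta> \<Longrightarrow> mv_cong_gen A R \<subseteq> \<theta>"
proof -
  let ?C = "{\<theta>. mv_congruence A \<theta> \<and> R \<subseteq> \<theta>}"
  have "carr A \<times> carr A \<in> ?C"
    using R by (auto simp: mv_congruence_def refl_on_def sym_def trans_def closedD[OF A] intro!: equivI)
  then have "mv_cong_gen A R \<subseteq> carr A \<times> carr A"
    unfolding mv_cong_gen_def by blast
  moreover have "refl_on (carr A) (mv_cong_gen A R)" "sym (mv_cong_gen A R)" "trans (mv_cong_gen A R)"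
  proof -
    show "refl_on (carr A) (mv_cong_gen A R)"
      by (auto simp: mv_cong_gen_def mv_congruence_def equiv_def refl_on_def)
    show "sym (mv_cong_gen A R)"
      unfolding mv_cong_gen_def mv_congruence_def equiv_def by (intro symI InterI) (auto dest: symD)
    show "trans (mv_cong_gen A R)"
      unfolding mv_cong_gen_def mv_congruence_def equiv_def by (intro transI InterI) (auto dest: transD)
  qed
  ultimately have "equiv (carr A) (mv_cong_gen A R)"
    by (intro equivI)
  then show "mv_congruence A (mv_cong_gen A R)"
    by (auto simp: mv_congruence_def mv_cong_gen_def)
  show "R \<subseteq> mv_cong_gen A R" "\<And>\<theta>. mv_congruence A \<theta> \<Longrightarrow> R \<subseteq> \<theta> \<Longrightarrow> mv_cong_gen A R \<subseteq> \<theta>"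
    unfolding mv_cong_gen_def by blast+
qed

lemma iso_inverse:
  assumes A: "mv_closed A" and f: "mv_iso A B f"
  shows "mv_iso B A (inv_into (carr A) f)"
proof -
  define g where "g = inv_into (carr A) f"
  have hom: "mv_hom A B f" and bij: "bij_betw f (carr A) (carr B)"
    using f by (auto simp: mv_iso_def)
  have gc: "g y \<in> carr A" "f (g y) = y" if "y \<in> carr B" for y
    using that bij unfolding g_def bij_betw_def by (auto intro: inv_into_into f_inv_into_f)
  have gf: "g (f x) = x" if "x \<in> carr A" for x
    using that bij unfolding g_def bij_betw_def by auto
  have "mv_hom B A g"
    unfolding mv_hom_def
  proof (intro conjI ballI)
    show "g ` carr B \<subseteq> carr A" using gc by blast
    show "g \<zero>\<^bsub>B\<^esub> = \<zero>\<^bsub>A\<^esub>"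
      using gf[OF closedD(1)[OF A]] hom by (simp add: mv_hom_def)
    show "g (\<sim>\<^bsub>B\<^esub> x) = \<sim>\<^bsub>A\<^esub> (g x)" if "x \<in> carr B" for x
      using gf[OF closedD(2)[OF A]] gc[OF that] hom unfolding mv_hom_def by metis
    show "g (x \<oplus>\<^bsub>B\<^esub> y) = g x \<oplus>\<^bsub>A\<^esub> g y" if "x \<in> carr B" "y \<in> carr B" for x y
      using gf[OF closedD(3)[OF A]] gc[OF that(1)] gc[OF that(2)] hom unfolding mv_hom_def by metis
  qed
  moreover have "bij_betw g (carr B) (carr A)"
    unfolding g_def using bij by (rule bij_betw_inv_into)
  ultimately show ?thesis
    by (simp add: mv_iso_def g_def)
qed

lemma isomorphic_quot_kernel:
  assumes F: "mv_closed F" and f: "mv_hom F C f" "f ` carr F = carr C"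
    and \<theta>: "mv_congruence F \<theta>"
    and ker: "\<And>x y. x \<in> carr F \<Longrightarrow> y \<in> carr F \<Longrightarrow> (x, y) \<in> \<theta> \<longleftrightarrow> f x = f y"
  shows "mv_isomorphic C (mv_quot F \<theta>)"
proof -
  have eq: "equiv (carr F) \<theta>"
    using \<theta> by (simp add: mv_congruence_def)
  have proj: "f (mv_proj \<theta> x) = f x" if "x \<in> carr F" for x
    using that proj_class[OF eq] proj_in_carr[OF eq] ker by metis
  have "inj_on f (carr (mv_quot F \<theta>))"
    by (rule inj_onI) (auto simp: mv_quot_def proj proj_eq_iff[OF eq] ker)
  moreover have "f ` carr (mv_quot F \<theta>) = carr C"
    using f(2) by (auto simp: mv_quot_def image_image proj cong: image_cong_simp)
  moreover have "mv_hom (mv_quot F \<theta>) C f"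
    using f(1) unfolding mv_hom_def
    by (auto simp: mv_quot_def proj closedD[OF F] proj_in_carr[OF eq])
  ultimately have "mv_iso (mv_quot F \<theta>) C f"
    by (simp add: mv_iso_def bij_betw_def)
  with hom_surj_closed[OF F quot_hom[OF F \<theta>]] show ?thesis
    unfolding mv_isomorphic_def by (blast intro: iso_inverse)
qed

lemma hom_comp: "mv_hom A B f \<Longrightarrow> mv_hom B C g \<Longrightarrow> mv_hom A C (g \<circ> f)"
  by (auto simp: mv_hom_def image_subset_iff)

lemma model_surj_image:
  assumes A: "mv_model T A" and f: "mv_hom A B f" "f ` carr A = carr B"
  shows "mv_model T B"
proof -
  interpret A: mv_algebra A using A by (simp add: mv_model_def)
  note B = hom_surj_closed[OF A.mv_closed f]
  have f_ops: "\<zero>\<^bsub>B\<^esub> = f \<zero>\<^bsub>A\<^esub>" "\<And>x. x \<in> carr A \<Longrightarrow> \<sim>\<^bsub>B\<^esub> (f x) = f (\<sim>\<^bsub>A\<^esub> x)"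
    "\<And>x y. x \<in> carr A \<Longrightarrow> y \<in> carr A \<Longrightarrow> f x \<oplus>\<^bsub>B\<^esub> f y = f (x \<oplus>\<^bsub>A\<^esub> y)"
    using f(1) by (auto simp: mv_hom_def)
  note [simp] = f_ops A.zero_closed A.neg_closed A.plus_closed
  have "mv_algebra B"
  proof
    show "x \<oplus>\<^bsub>B\<^esub> y \<oplus>\<^bsub>B\<^esub> z = x \<oplus>\<^bsub>B\<^esub> (y \<oplus>\<^bsub>B\<^esub> z)" if "x \<in> carr B" "y \<in> carr B" "z \<in> carr B" for x y z
      using that by (auto simp: A.plus_assoc simp flip: f(2))
    show "x \<oplus>\<^bsub>B\<^esub> y = y \<oplus>\<^bsub>B\<^esub> x" if "x \<in> carr B" "y \<in> carr B" for x y
      using that by (auto simp: A.plus_comm simp flip: f(2))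
    show "x \<oplus>\<^bsub>B\<^esub> \<zero>\<^bsub>B\<^esub> = x" "\<sim>\<^bsub>B\<^esub> (\<sim>\<^bsub>B\<^esub> x) = x" "x \<oplus>\<^bsub>B\<^esub> \<sim>\<^bsub>B\<^esub> \<zero>\<^bsub>B\<^esub> = \<sim>\<^bsub>B\<^esub> \<zero>\<^bsub>B\<^esub>"
      if "x \<in> carr B" for x
      using that by (auto simp: A.plus_zero A.neg_neg A.plus_neg_zero simp flip: f(2))
    show "\<sim>\<^bsub>B\<^esub> (\<sim>\<^bsub>B\<^esub> x \<oplus>\<^bsub>B\<^esub> y) \<oplus>\<^bsub>B\<^esub> y = \<sim>\<^bsub>B\<^esub> (\<sim>\<^bsub>B\<^esub> y \<oplus>\<^bsub>B\<^esub> x) \<oplus>\<^bsub>B\<^esub> x"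
      if "x \<in> carr B" "y \<in> carr B" for x y
    proof -
      obtain a b where "a \<in> carr A" "b \<in> carr A" "x = f a" "y = f b"
        using \<open>x \<in> carr B\<close> \<open>y \<in> carr B\<close> f(2) by blast
      then show ?thesis using A.lukasiewicz[of a b] by simp
    qed
  qed (use closedD[OF B] in auto)
  moreover have "mv_satisfies B s t" if st: "mv_satisfies A s t" for s t
    unfolding mv_satisfies_def
  proof (intro allI impI)
    fix v :: "nat \<Rightarrow> 'b" assume "range v \<subseteq> carr B"
    then have "\<forall>i. \<exists>a. a \<in> carr A \<and> v i = f a"
      using f(2) by blast
    then obtain w where w: "\<And>i. w i \<in> carr A" "v = f \<circ> w"
      by (metis comp_apply ext)
    have "range w \<subseteq> carr A" using w(1) by blast
    then have "mv_eval A w s = mv_eval A w t"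
      using st by (simp add: mv_satisfies_def)
    then show "mv_eval B v s = mv_eval B v t"
      using hom_eval[OF A.mv_closed f(1), of _ w] w by metis
  qed
  ultimately show ?thesis
    using A by (auto simp: mv_model_def)
qed

section \<open>The variety generated by the chains whose rank divides n\<close>

text \<open>
  Membership in the variety generated by all \<open>S_omega_alg m\<close> with \<open>m\<close> dividing \<open>n\<close>. It contains the
  Komori variety with invariant \<open>n\<close>, and being checked on chains only it allows every fact about the
  Boolean terms to be proved by a case distinction.
\<close>
locale komori = mv_algebra A for A :: "'a mv" (structure) +
  fixes n :: nat
  assumes n_pos: "0 < n"
    and identity: "(\<And>m. 0 < m \<Longrightarrow> m dvd n \<Longrightarrow> mv_satisfies (S_omega_alg m) s t) \<Longrightarrow> mv_satisfies A s t"

lemma komori_model: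
  assumes I: "finite I" "finite J" and pos: "\<forall>m\<in>I \<union> J. 0 < m" and n: "n = Lcm (I \<union> J)"
    and A: "mv_model (Komori_theory I J) A"
  shows "komori A n"
proof -
  have "0 < n"
    using I pos by (auto simp: n Lcm_0_iff_nat intro!: gr0I)
  moreover have "mv_satisfies A s t"
    if st: "\<And>m. 0 < m \<Longrightarrow> m dvd n \<Longrightarrow> mv_satisfies (S_omega_alg m) s t" for s t
  proof -
    have omega: "mv_satisfies (S_omega_alg m) s t" if "m \<in> I \<union> J" for m
      using st that pos dvd_Lcm[OF that] by (auto simp: n)
    have "mv_satisfies (S_alg m) s t" if "m \<in> I \<union> J" for m
      unfolding mv_satisfies_def
    proof (intro allI impI)
      fix v :: "nat \<Rightarrow> int" assume v: "range v \<subseteq> carr (S_alg m)"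
      then have "range ((\<lambda>a. (a, 0)) \<circ> v) \<subseteq> carr (S_omega_alg m)"
        by (auto simp: int_chain_ops lex_chain_carr image_subset_iff)
      then have "(mv_eval (S_alg m) v s, 0::int) = (mv_eval (S_alg m) v t, 0)"
        using omega[OF that] unfolding preserves_eval[OF embed_preserves] mv_satisfies_def by blast
      then show "mv_eval (S_alg m) v s = mv_eval (S_alg m) v t"
        by simp
    qed
    then have "(s, t) \<in> Komori_theory I J"
      using omega by (auto simp: Komori_theory_def)
    then show ?thesis
      using A by (auto simp: mv_model_def)
  qed
  ultimately show ?thesis
    using A by (simp add: komori_def komori_axioms_def mv_model_def)
qed

text \<open>
  Rules that evaluate expressions in \<open>S_omega_alg m\<close> whose values are \<open>0\<close> and \<open>1\<close>.
\<close>
lemma lex_chain_eq_iff: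
  assumes "0 < m" shows "(0::int, 0::int) = (int m, 0) \<longleftrightarrow> False" "(int m, 0) = (0::int, 0::int) \<longleftrightarrow> False"
  using assms by auto

lemma lex_chain_01:
  "\<sim>\<^bsub>S_omega_alg m\<^esub> (0, 0) = (int m, 0)" "\<sim>\<^bsub>S_omega_alg m\<^esub> (int m, 0) = (0, 0)"
  "z \<in> carr (S_omega_alg m) \<Longrightarrow> (0, 0) \<oplus>\<^bsub>S_omega_alg m\<^esub> z = z"
  "z \<in> carr (S_omega_alg m) \<Longrightarrow> z \<oplus>\<^bsub>S_omega_alg m\<^esub> (0, 0) = z"
  "z \<in> carr (S_omega_alg m) \<Longrightarrow> (int m, 0) \<oplus>\<^bsub>S_omega_alg m\<^esub> z = (int m, 0)"
  "z \<in> carr (S_omega_alg m) \<Longrightarrow> z \<oplus>\<^bsub>S_omega_alg m\<^esub> (int m, 0) = (int m, 0)"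
  "(0, 0) \<in> carr (S_omega_alg m)" "(int m, 0) \<in> carr (S_omega_alg m)"
  "z \<in> carr (S_omega_alg m) \<Longrightarrow> \<sim>\<^bsub>S_omega_alg m\<^esub> (\<sim>\<^bsub>S_omega_alg m\<^esub> z) = z"
  unfolding lex_chain_ops zero_prod_def[symmetric]
  by (simp_all add: min_absorb1 min_absorb2 less_eq_prod_def[of 0] zero_prod_def[symmetric])

lemma fst_chain:
  "fst (\<sim>\<^bsub>S_omega_alg m\<^esub> z) = int m - fst z"
  "fst (z \<oplus>\<^bsub>S_omega_alg m\<^esub> w) = min (fst z + fst w) (int m)"
  by (simp_all add: preserves_basic[OF fst_preserves] int_chain_ops)

context komori
begin

text \<open>
  Three variables suffice for all identities needed below.
\<close>
lemma identity_eval: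
  assumes "\<And>m w. 0 < m \<Longrightarrow> m dvd n \<Longrightarrow> m \<le> n \<Longrightarrow> (\<And>i. w i \<in> carr (S_omega_alg m)) \<Longrightarrow>
      mv_eval (S_omega_alg m) w s = mv_eval (S_omega_alg m) w t"
    and "x \<in> carr A" "y \<in> carr A" "z \<in> carr A"
  shows "mv_eval A (\<lambda>i. if i = 0 then x else if i = 1 then y else z) s = mv_eval A (\<lambda>i. if i = 0 then x else if i = 1 then y else z) t"
proof -
  have "mv_satisfies A s t"
    by (rule identity) (auto simp: mv_satisfies_def image_subset_iff n_pos dvd_imp_le intro!: assms(1))
  then show ?thesis
    using assms(2-) unfolding mv_satisfies_def by (auto simp: image_subset_iff)
qed

lemmas closed = zero_closed neg_closed plus_closed closed_ops[OF mv_closed]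
lemmas chain_closed = closedD[OF lex_chain_closed] closed_ops[OF lex_chain_closed]
lemmas chain_simps = eval_TM lex_chain_J1 lex_chain_Fin_defect lex_chain_01 chain_closed lex_chain_eq_iff

lemma J1_J1: assumes "x \<in> carr A" shows "J1 n A x \<oplus> J1 n A x = J1 n A x"
  using identity_eval[of "Plus (J1 n TM (Var 0)) (J1 n TM (Var 0))" "J1 n TM (Var 0)" x x x] assms
  by (simp add: chain_simps)

lemma neg_J1: assumes "x \<in> carr A" shows "\<sim> (J1 n A x) \<oplus> \<sim> (J1 n A x) = \<sim> (J1 n A x)"
  using identity_eval[of "Plus (Neg (J1 n TM (Var 0))) (Neg (J1 n TM (Var 0)))" "Neg (J1 n TM (Var 0))" x x x] assms
  by (simp add: chain_simps)

lemma J1_neg: assumes x: "x \<in> carr A" shows "J1 n A x \<oplus> J1 n A (\<sim> x) = \<one>"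
proof -
  have *: "mv_eval (S_omega_alg m) w (Plus (J1 n TM (Var 0)) (J1 n TM (Neg (Var 0)))) =
      mv_eval (S_omega_alg m) w (Neg Zero)"
    if "0 < m" "m \<le> n" "\<And>i. w i \<in> carr (S_omega_alg m)" for m w
    using that by (cases "fst (w 0) = 0") (simp_all add: chain_simps fst_chain lex_chain_ops(3))
  have "mv_eval A (\<lambda>i. if i = 0 then x else if i = 1 then x else x) (Plus (J1 n TM (Var 0)) (J1 n TM (Neg (Var 0)))) = mv_eval A (\<lambda>i. if i = 0 then x else if i = 1 then x else x) (Neg Zero)"
    by (rule identity_eval) (use * x in blast)+
  then show ?thesis
    by (simp add: eval_TM mv_one_def)
qed

text \<open>
  Only the unit squares to the unit.
\<close>
lemma J1_one:
  assumes x: "x \<in> carr A" and J: "J1 n A x = \<one>"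
  shows "mv_mult A (n + 1) x = \<one>"
proof -
  define y where "y = mv_mult A (n + 1) x"
  have y: "y \<in> carr A"
    using x by (simp add: y_def closed)
  have c: "y \<odot> \<one> \<in> carr A"
    using y by (simp add: mv_times_def closed one_closed)
  have "\<sim> (\<sim> y \<oplus> \<sim> (y \<odot> \<one>)) = \<one>"
    using J by (simp add: J1_def y_def mv_pow_def mv_times_def eval_nat_numeral)
  then have "\<sim> y \<oplus> \<sim> (y \<odot> \<one>) = \<zero>"
    using y c by (metis closed(2,3) neg_neg neg_one)
  then have "\<sim> y = \<zero>"
    using y c by (simp add: plus_eq_zero closed)
  then show ?thesis
    using y by (metis y_def mv_one_def neg_neg)
qed

text \<open>
  The identities behind the decomposition by \<open>c = J1 n A z\<close>: an element is recovered from its classes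
  modulo \<open>c\<close> and modulo \<open>\<sim> c\<close>, and any two classes come from a common element. On a chain \<open>c\<close> is
  \<open>0\<close> or \<open>1\<close>, and then both are evident.
\<close>
lemma boolean_split:
  assumes "x \<in> carr A" "z \<in> carr A"
  shows "(x \<oplus> J1 n A z) \<odot> (x \<oplus> \<sim> (J1 n A z)) = x"
  using identity_eval[of "Neg (Plus (Neg (Plus (Var 0) (J1 n TM (Var 1)))) (Neg (Plus (Var 0) (Neg (J1 n TM (Var 1))))))" "Var 0" x z z] assms
  by (simp add: chain_simps mv_times_def)

lemma boolean_glue:
  assumes "x \<in> carr A" "y \<in> carr A" "z \<in> carr A"
  defines "w \<equiv> (x \<oplus> J1 n A z) \<odot> (y \<oplus> \<sim> (J1 n A z))"
  shows "w \<oplus> J1 n A z = x \<oplus> J1 n A z" "w \<oplus> \<sim> (J1 n A z) = y \<oplus> \<sim> (J1 n A z)"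
proof -
  define c where "c = J1 n TM (Var 2)"
  define t where "t = Neg (Plus (Neg (Plus (Var 0) c)) (Neg (Plus (Var 1) (Neg c))))"
  show "w \<oplus> J1 n A z = x \<oplus> J1 n A z"
    using identity_eval[of "Plus t c" "Plus (Var 0) c" x y z] assms
    by (simp add: chain_simps t_def c_def mv_times_def)
  show "w \<oplus> \<sim> (J1 n A z) = y \<oplus> \<sim> (J1 n A z)"
    using identity_eval[of "Plus t (Neg c)" "Plus (Var 1) (Neg c)" x y z] assms
    by (simp add: chain_simps t_def c_def mv_times_def)
qed

text \<open>
  Hence splitting by \<open>J1\<close> of the defect amounts to splitting by the defect itself.
\<close>
lemma Fin_defect_J1: assumes "x \<in> carr A" "d \<le> n" shows "J1 n A (Fin_defect n A d x) = Fin_defect n A d x"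
  using identity_eval[of "J1 n TM (Fin_defect n TM d (Var 0))" "Fin_defect n TM d (Var 0)" x x x] assms
  by (simp add: chain_simps)

lemma Fin_defect_zero: "Fin_defect n A 0 \<zero> = \<zero>"
  using identity_eval[of "Fin_defect n TM 0 Zero" "Zero" \<zero> \<zero> \<zero>]
  by (simp add: chain_simps zero_closed lex_chain_ops(3))

lemma Fin_defect_neg:
  assumes "x \<in> carr A" "d \<le> n"
  shows "Fin_defect n A (n - d) (\<sim> x) = Fin_defect n A d x"
proof -
  have "int n * fst (\<sim>\<^bsub>S_omega_alg m\<^esub> z) = int (n - d) * int m \<longleftrightarrow> int n * fst z = int d * int m" for m z
    using assms(2) by (auto simp: lex_chain_ops of_nat_diff algebra_simps)
  then show ?thesis
  using identity_eval[of "Fin_defect n TM (n - d) (Neg (Var 0))" "Fin_defect n TM d (Var 0)" x x x] assms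
  by (simp add: chain_simps)
qed

lemma Fin_defect_plus:
  assumes "x \<in> carr A" "y \<in> carr A" "d \<le> n" "e \<le> n"
  shows "mv_le A (Fin_defect n A (min n (d + e)) (x \<oplus> y)) (Fin_defect n A d x \<oplus> Fin_defect n A e y)"
proof -
  have *: "int n * fst (z \<oplus>\<^bsub>S_omega_alg m\<^esub> w) = int (min n (d + e)) * int m"
    if "int n * fst z = int d * int m" "int n * fst w = int e * int m" for z w m
  proof -
    have "fst (z \<oplus>\<^bsub>S_omega_alg m\<^esub> w) = min (fst z + fst w) (int m)"
      by (rule fst_chain)
    then have "int n * fst (z \<oplus>\<^bsub>S_omega_alg m\<^esub> w) = min (int n * (fst z + fst w)) (int n * int m)"
      by (simp add: min_mult_distrib_left)
    also have "\<dots> = min ((int d + int e) * int m) (int n * int m)"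
      using that by (simp add: algebra_simps)
    also have "\<dots> = min (int d + int e) (int n) * int m"
      by (simp add: min_mult_distrib_right)
    finally show ?thesis
      by (simp add: of_nat_min min.commute)
  qed
  show ?thesis
    using identity_eval[of "Plus (Neg (Fin_defect n TM (min n (d + e)) (Plus (Var 0) (Var 1))))
      (Plus (Fin_defect n TM d (Var 0)) (Fin_defect n TM e (Var 1)))" "Neg Zero" x y y] assms
    by (auto simp: chain_simps mv_le_def mv_one_def *  lex_chain_ops(3))
qed

lemma Fin_defect_pos: assumes "x \<in> carr A" "0 < d" "d \<le> n" shows "J1 n A x \<oplus> Fin_defect n A d x = \<one>"
  using identity_eval[of "Plus (J1 n TM (Var 0)) (Fin_defect n TM d (Var 0))" "Neg Zero" x x x] assms
  by (auto simp: chain_simps mv_one_def lex_chain_ops(3))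

text \<open>
  The rank \<open>m\<close> of a chain divides \<open>n\<close>, so every \<open>a / m\<close> is one of the fractions \<open>d / n\<close>: at least one
  defect vanishes, and the sum of the complements of the defects is the unit.
\<close>
lemma Fin_defect_exhaust:
  assumes x: "x \<in> carr A"
  shows "foldr (\<lambda>d y. \<sim> (Fin_defect n A d x) \<oplus> y) [0..<n + 1] \<zero> = \<one>"
proof -
  define t where "t ds = foldr (\<lambda>d y. Plus (Neg (Fin_defect n TM d (Var 0))) y) ds Zero" for ds
  have t: "mv_eval B w (t ds) = foldr (\<lambda>d y. \<sim>\<^bsub>B\<^esub> (Fin_defect n B d (w 0)) \<oplus>\<^bsub>B\<^esub> y) ds \<zero>\<^bsub>B\<^esub>" for B :: "'b mv" and w ds
    by (induction ds) (simp_all add: t_def eval_TM)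
  have chain: "mv_eval (S_omega_alg m) w (t ds) =
      (if \<exists>d\<in>set ds. int n * fst (w 0) = int d * int m then (int m, 0) else (0, 0))"
    if "0 < m" "m \<le> n" "\<And>i. w i \<in> carr (S_omega_alg m)" "set ds \<subseteq> {..n}" for m w ds
    using that(4) unfolding t by (induction ds) (auto simp: chain_simps that lex_chain_ops(3))
  have ex: "\<exists>d\<in>set [0..<n + 1]. int n * fst z = int d * int m"
    if "0 < m" "m dvd n" "z \<in> carr (S_omega_alg m)" for m z
  proof -
    obtain q where q: "n = m * q" using \<open>m dvd n\<close> by blast
    define a where "a = nat (fst z)"
    have a: "fst z = int a" "a \<le> m"
      using that(3) by (cases z, auto simp: lex_chain_carr a_def)+
    have "q * a \<le> n"
      using a q by simp
    moreover have "int n * fst z = int (q * a) * int m"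
      by (simp add: q a)
    ultimately show ?thesis
      by (intro bexI[of _ "q * a"]) (simp_all del: upt_Suc)
  qed
  have *: "mv_eval (S_omega_alg m) w (t [0..<n + 1]) = mv_eval (S_omega_alg m) w (Neg Zero)"
    if "0 < m" "m dvd n" "m \<le> n" "\<And>i. w i \<in> carr (S_omega_alg m)" for m w
  proof -
    have "set [0..<n + 1] \<subseteq> {..n}" by auto
    then show ?thesis
      using chain[OF that(1,3,4), of "[0..<n + 1]"] ex[OF that(1,2) that(4)[of 0]]
      by (simp add: lex_chain_01 lex_chain_ops(3) del: upt_Suc)
  qed
  have "mv_eval A (\<lambda>i. if i = 0 then x else if i = 1 then x else x) (t [0..<n + 1]) = mv_eval A (\<lambda>i. if i = 0 then x else if i = 1 then x else x) (Neg Zero)"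
    by (rule identity_eval) (use * x in blast)+
  then show ?thesis
    by (simp add: t mv_one_def del: upt_Suc)
qed

lemma Fin_iff_defect:
  assumes x: "x \<in> carr A"
  shows "mv_Fin A n d x \<longleftrightarrow> Fin_defect n A d x = \<zero>"
proof -
  have "foldr (\<lambda>e y. J1 n A e \<oplus> y) es \<zero> \<in> carr A \<and>
      (foldr (\<lambda>e y. J1 n A e \<oplus> y) es \<zero> = \<zero> \<longleftrightarrow> (\<forall>e\<in>set es. J1 n A e = \<zero>))"
    if "set es \<subseteq> carr A" for es
    using that by (induction es) (auto simp: closed plus_eq_zero)
  from this[OF Fin_errors_closed[OF mv_closed x]]
  have "Fin_defect n A d x = \<zero> \<longleftrightarrow> (\<forall>e\<in>set (Fin_errors n A d x). J1 n A e = \<zero>)"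
    by (simp add: Fin_defect_def)
  then show ?thesis
    by (auto simp: mv_Fin_def mv_near_def J1_def Fin_errors_def less_Suc_eq_le simp del: upt_Suc)
qed

text \<open>
  A local algebra has no Boolean elements other than \<open>0\<close> and \<open>1\<close>. Conversely, \<open>J1 n A x = 1\<close> means that
  \<open>n + 1\<close> copies of \<open>x\<close> reach the unit, and of \<open>x\<close> and \<open>\<sim> x\<close> at least one is not infinitesimal.
\<close>
lemma local_iff_J1:
  "mv_local A \<longleftrightarrow> mv_nontrivial A \<and> (\<forall>x\<in>carr A. J1 n A x \<in> {\<zero>, \<one>})"
proof (intro iffI conjI ballI)
  assume loc: "mv_local A"
  then show "mv_nontrivial A"
    by (simp add: mv_local_def)
  fix x assume x: "x \<in> carr A"
  let ?c = "J1 n A x"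
  obtain k where k: "k \<ge> 1" "mv_mult A k ?c = \<one> \<or> mv_mult A k (\<sim> ?c) = \<one>"
    using loc closed(6)[OF x] unfolding mv_local_def by blast
  then have "?c = \<one> \<or> \<sim> ?c = \<one>"
    using x by (simp add: mult_boolean J1_J1 neg_J1 closed)
  then show "?c \<in> {\<zero>, \<one>}"
    using neg_neg[OF closed(6)[OF x]] neg_one by (metis insertCI)
next
  assume r: "mv_nontrivial A \<and> (\<forall>x\<in>carr A. J1 n A x \<in> {\<zero>, \<one>})"
  show "mv_local A"
    unfolding mv_local_def
  proof (intro conjI ballI)
    show "mv_algebra A" by (rule mv_algebra_axioms)
    fix x assume x: "x \<in> carr A"
    have "J1 n A x = \<one> \<or> J1 n A (\<sim> x) = \<one>"
      using r x J1_neg[OF x] by (auto simp: zero_plus closed)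
    then show "\<exists>k\<ge>1. mv_mult A k x = \<one> \<or> mv_mult A k (\<sim> x) = \<one>"
      using J1_one[OF x] J1_one[OF neg_closed[OF x]] by (intro exI[of _ "n + 1"]) auto
  qed (use r in auto)
qed

lemma le_zero: "x \<in> carr A \<Longrightarrow> mv_le A x \<zero> \<Longrightarrow> x = \<zero>"
  by (metis le_iff_plus plus_eq_zero zero_closed)

text \<open>
  The fractions \<open>d / n\<close> are closed under negation and truncated addition. This is why conditions on
  generators control the whole algebra.
\<close>
lemma Fin_subalgebra: "mv_subalgebra A {x \<in> carr A. \<exists>d\<le>n. Fin_defect n A d x = \<zero>}"
  unfolding mv_subalgebra_def
proof (intro conjI ballI)
  show "\<zero> \<in> {x \<in> carr A. \<exists>d\<le>n. Fin_defect n A d x = \<zero>}"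
    using Fin_defect_zero zero_closed by auto
  fix x assume "x \<in> {x \<in> carr A. \<exists>d\<le>n. Fin_defect n A d x = \<zero>}"
  then obtain d where x: "x \<in> carr A" "d \<le> n" "Fin_defect n A d x = \<zero>"
    by blast
  show "\<sim> x \<in> {x \<in> carr A. \<exists>d\<le>n. Fin_defect n A d x = \<zero>}"
    using x Fin_defect_neg[of x d] by (auto simp: closed intro!: exI[of _ "n - d"])
  fix y assume "y \<in> {x \<in> carr A. \<exists>d\<le>n. Fin_defect n A d x = \<zero>}"
  then obtain e where y: "y \<in> carr A" "e \<le> n" "Fin_defect n A e y = \<zero>"
    by blast
  have "Fin_defect n A (min n (d + e)) (x \<oplus> y) = \<zero>"
    using Fin_defect_plus[OF x(1) y(1) x(2) y(2)] x y by (intro le_zero) (simp_all add: closed plus_zero)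
  then show "x \<oplus> y \<in> {x \<in> carr A. \<exists>d\<le>n. Fin_defect n A d x = \<zero>}"
    using x y by (auto simp: closed intro!: exI[of _ "min n (d + e)"])
qed auto

lemma J1_of_Fin:
  assumes x: "x \<in> carr A" "d \<le> n" "Fin_defect n A d x = \<zero>"
  shows "J1 n A x \<in> {\<zero>, \<one>}"
proof (cases "d = 0")
  case True
  then show ?thesis
    using x by (simp add: Fin_defect_def Fin_errors_def plus_zero closed)
next
  case False
  then show ?thesis
    using x Fin_defect_pos[of x d] by (simp add: plus_zero closed)
qed

lemma Fin_exists:
  assumes x: "x \<in> carr A" and dec: "\<And>d. d \<le> n \<Longrightarrow> Fin_defect n A d x \<in> {\<zero>, \<one>}"
  shows "\<exists>d\<le>n. Fin_defect n A d x = \<zero>"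
proof (rule ccontr)
  assume "\<not> (\<exists>d\<le>n. Fin_defect n A d x = \<zero>)"
  then have "Fin_defect n A d x = \<one>" "\<zero> \<noteq> \<one>" if "d \<le> n" for d
    using dec that by auto
  then have "foldr (\<lambda>d y. \<sim> (Fin_defect n A d x) \<oplus> y) ds \<zero> = \<zero>" if "set ds \<subseteq> {..n}" for ds
    using that by (induction ds) (auto simp: neg_one plus_zero zero_closed)
  moreover have "set [0..<n + 1] \<subseteq> {..n}" by auto
  ultimately have "\<zero> = \<one>"
    using Fin_defect_exhaust[OF x] by metis
  then show False
    using \<open>\<And>d. d \<le> n \<Longrightarrow> \<zero> \<noteq> \<one>\<close> by blast
qed

end

section \<open>Finite presentations\<close>

lemma komori_theory_congruence:
  "mv_congruence (mv_term_algebra k)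
    (Komori_theory I J \<inter> carr (mv_term_algebra k) \<times> carr (mv_term_algebra k))"
  unfolding mv_congruence_def
proof (intro conjI)
  show "equiv (carr (mv_term_algebra k))
    (Komori_theory I J \<inter> carr (mv_term_algebra k) \<times> carr (mv_term_algebra k))"
    by (rule equivI) (auto simp: refl_on_def sym_def trans_def Komori_theory_def mv_satisfies_def)
qed (auto simp: Komori_theory_def mv_satisfies_def TM_ops mv_term_algebra_def)

lemma term_algebra_closed: "mv_closed (mv_term_algebra k)"
  by (auto simp: mv_closed_def mv_subalgebra_def mv_term_algebra_def)

lemma komori_theory_plus_zero: "(Plus t Zero, t) \<in> Komori_theory I J"
proof -
  have "mv_eval (S_alg m) v t \<in> carr (S_alg m)" if "range v \<subseteq> carr (S_alg m)" for v m
    using that by (intro eval_closed[OF int_chain_closed]) auto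
  moreover have "mv_eval (S_omega_alg m) v t \<in> carr (S_omega_alg m)" if "range v \<subseteq> carr (S_omega_alg m)" for v m
    using that by (intro eval_closed[OF lex_chain_closed]) auto
  ultimately show ?thesis
    by (auto simp: Komori_theory_def mv_satisfies_def lex_chain_01(4) lex_chain_ops(3))
      (fastforce simp: int_chain_ops)
qed

abbreviation komori_free :: "nat set \<Rightarrow> nat set \<Rightarrow> nat \<Rightarrow> mv_term mv" where
  "komori_free I J k \<equiv> mv_free (Komori_theory I J) k"

lemma komori_free_proj:
  defines "T \<equiv> \<lambda>I J k. Komori_theory I J \<inter> carr (mv_term_algebra k) \<times> carr (mv_term_algebra k)"
  shows "mv_hom (mv_term_algebra k) (komori_free I J k) (mv_proj (T I J k))"
    "mv_proj (T I J k) ` carr (mv_term_algebra k) = carr (komori_free I J k)"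
  unfolding mv_free_def T_def
  by (rule quot_hom[OF term_algebra_closed komori_theory_congruence])+

lemma komori_free_closed: "mv_closed (komori_free I J k)"
  by (rule hom_surj_closed[OF term_algebra_closed komori_free_proj])

lemma komori_free_plus_zero:
  assumes x: "x \<in> carr (komori_free I J k)"
  shows "x \<oplus>\<^bsub>komori_free I J k\<^esub> \<zero>\<^bsub>komori_free I J k\<^esub> = x"
proof -
  define T where "T = Komori_theory I J \<inter> carr (mv_term_algebra k) \<times> carr (mv_term_algebra k)"
  note g = komori_free_proj[where I = I and J = J and k = k, folded T_def]
  obtain t where t: "t \<in> carr (mv_term_algebra k)" "x = mv_proj T t"
    using x g(2) by blast
  then have "x \<oplus>\<^bsub>komori_free I J k\<^esub> \<zero>\<^bsub>komori_free I J k\<^esub> = mv_proj T (Plus t Zero)"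
    using g(1) closedD(1)[OF term_algebra_closed, of k] by (simp add: mv_hom_def TM_ops)
  also have "\<dots> = mv_proj T t"
  proof (subst proj_eq_iff)
    show "equiv (carr (mv_term_algebra k)) T"
      using komori_theory_congruence unfolding T_def mv_congruence_def by blast
    show "Plus t Zero \<in> carr (mv_term_algebra k)" "(Plus t Zero, t) \<in> T"
      using t komori_theory_plus_zero by (auto simp: mv_term_algebra_def T_def)
  qed (use t in auto)
  finally show ?thesis using t by simp
qed

lemma fp_presentation:
  assumes fp: "finitely_presentable (Komori_theory I J) A"
  obtains k R f where "finite R" "R \<subseteq> carr (komori_free I J k) \<times> carr (komori_free I J k)"
    "mv_hom (komori_free I J k) A f" "f ` carr (komori_free I J k) = carr A"
    "\<forall>x\<in>carr (komori_free I J k). \<forall>y\<in>carr (komori_free I J k).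
      (x, y) \<in> mv_cong_gen (komori_free I J k) R \<longleftrightarrow> f x = f y"
proof -
  obtain k R h where R: "finite R" "R \<subseteq> carr (komori_free I J k) \<times> carr (komori_free I J k)"
    and h: "mv_iso A (mv_quot (komori_free I J k) (mv_cong_gen (komori_free I J k) R)) h"
    using fp unfolding finitely_presentable_def mv_isomorphic_def by blast
  let ?F = "komori_free I J k" and ?\<theta> = "mv_cong_gen (komori_free I J k) R"
  note cg = cong_gen[OF komori_free_closed R(2)]
  note q = quot_hom[OF komori_free_closed cg(1)]
  have A: "mv_closed A"
    using fp by (simp add: finitely_presentable_def mv_model_def mv_algebra.mv_closed)
  define h' where "h' = inv_into (carr A) h"
  have h': "mv_hom (mv_quot ?F ?\<theta>) A h'" "bij_betw h' (carr (mv_quot ?F ?\<theta>)) (carr A)"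
    using iso_inverse[OF A h] by (simp_all add: h'_def mv_iso_def)
  show thesis
  proof (rule that[OF R hom_comp[OF q(1) h'(1)]])
    show "(h' \<circ> mv_proj ?\<theta>) ` carr ?F = carr A"
      using h'(2) q(2) by (metis image_comp bij_betw_def)
    show "\<forall>x\<in>carr ?F. \<forall>y\<in>carr ?F.
        (x, y) \<in> ?\<theta> \<longleftrightarrow> (h' \<circ> mv_proj ?\<theta>) x = (h' \<circ> mv_proj ?\<theta>) y"
    proof (intro ballI)
      fix x y assume xy: "x \<in> carr ?F" "y \<in> carr ?F"
      have eq: "equiv (carr ?F) ?\<theta>" using cg(1) by (simp add: mv_congruence_def)
      have "h' (mv_proj ?\<theta> x) = h' (mv_proj ?\<theta> y) \<longleftrightarrow> mv_proj ?\<theta> x = mv_proj ?\<theta> y"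
        using inj_on_eq_iff[OF bij_betw_imp_inj_on[OF h'(2)]] q(2) xy by (metis imageI)
      then show "(x, y) \<in> ?\<theta> \<longleftrightarrow> (h' \<circ> mv_proj ?\<theta>) x = (h' \<circ> mv_proj ?\<theta>) y"
        using proj_eq_iff[OF eq xy] by simp
    qed
  qed
qed

lemma quot_boolean:
  assumes A: "mv_algebra A" and c: "c \<in> carr A" "c \<oplus>\<^bsub>A\<^esub> c = c"
  shows "mv_hom A (mv_quot_elem A c) (mv_proj_elem A c)"
    "mv_proj_elem A c ` carr A = carr (mv_quot_elem A c)"
    "x \<in> carr A \<Longrightarrow> y \<in> carr A \<Longrightarrow>
      mv_proj_elem A c x = mv_proj_elem A c y \<longleftrightarrow> x \<oplus>\<^bsub>A\<^esub> c = y \<oplus>\<^bsub>A\<^esub> c"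
proof -
  interpret mv_algebra A by fact
  note cong = congruence_boolean[OF c]
  show "mv_hom A (mv_quot_elem A c) (mv_proj_elem A c)"
    "mv_proj_elem A c ` carr A = carr (mv_quot_elem A c)"
    using quot_hom[OF mv_closed cong] .
  have "equiv (carr A) (mv_ideal_cong A (mv_ideal_gen A c))"
    using cong by (simp add: mv_congruence_def)
  then show "x \<in> carr A \<Longrightarrow> y \<in> carr A \<Longrightarrow>
      mv_proj_elem A c x = mv_proj_elem A c y \<longleftrightarrow> x \<oplus>\<^bsub>A\<^esub> c = y \<oplus>\<^bsub>A\<^esub> c"
    by (simp add: proj_eq_iff ideal_cong_boolean[OF c])
qed

text \<open>
  A presentation of the quotient by \<open>c\<close> arises by adding one relation \<open>b = 0\<close>, where \<open>b\<close> lifts \<open>c\<close>.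
  If \<open>x\<close> and \<open>y\<close> become equal modulo \<open>c\<close>, then \<open>x \<oplus> b\<close> and \<open>y \<oplus> b\<close> are identified by the old
  relations, and the new relation removes \<open>b\<close>; about the free algebra this uses only that
  \<open>0\<close> is neutral.
\<close>
lemma fp_quot_boolean:
  assumes fp: "finitely_presentable (Komori_theory I J) A" and c: "c \<in> carr A" "c \<oplus>\<^bsub>A\<^esub> c = c"
  shows "finitely_presentable (Komori_theory I J) (mv_quot_elem A c)"
proof -
  have model: "mv_model (Komori_theory I J) A" and A: "mv_algebra A"
    using fp by (auto simp: finitely_presentable_def mv_model_def)
  note q = quot_boolean[OF A c]
  obtain k R f where kR: "finite R" "R \<subseteq> carr (komori_free I J k) \<times> carr (komori_free I J k)"
    and f: "mv_hom (komori_free I J k) A f" "f ` carr (komori_free I J k) = carr A"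
    and ker: "\<forall>x\<in>carr (komori_free I J k). \<forall>y\<in>carr (komori_free I J k).
      (x, y) \<in> mv_cong_gen (komori_free I J k) R \<longleftrightarrow> f x = f y"
    by (rule fp_presentation[OF fp]) (rule that)
  define F where "F = komori_free I J k"
  note kR = kR[folded F_def] and f = f[folded F_def] and ker = ker[folded F_def]
    and F = komori_free_closed[of I J k, folded F_def]
    and zero = komori_free_plus_zero[of _ I J k, folded F_def]
  obtain b where b: "b \<in> carr F" "f b = c"
    using c(1) f(2) by (metis imageE)
  define R' where "R' = insert (b, \<zero>\<^bsub>F\<^esub>) R"
  have R': "finite R'" "R' \<subseteq> carr F \<times> carr F"
    using kR b closedD(1)[OF F] by (auto simp: R'_def)
  note cg = cong_gen[OF F R'(2)]
  let ?q = "mv_proj_elem A c"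
  have qf: "mv_hom F (mv_quot_elem A c) (?q \<circ> f)" "(?q \<circ> f) ` carr F = carr (mv_quot_elem A c)"
    using hom_comp[OF f(1) q(1)] f(2) q(2) by (auto simp only: image_comp[symmetric])
  have f_plus: "f (x \<oplus>\<^bsub>F\<^esub> y) = f x \<oplus>\<^bsub>A\<^esub> f y" if "x \<in> carr F" "y \<in> carr F" for x y
    using f(1) that by (simp add: mv_hom_def)
  have f_in: "f x \<in> carr A" if "x \<in> carr F" for x
    using f(2) that by blast
  define \<kappa> where "\<kappa> = {(x, y). x \<in> carr F \<and> y \<in> carr F \<and> ?q (f x) = ?q (f y)}"
  have "mv_congruence F \<kappa>"
    unfolding mv_congruence_def
  proof (intro conjI)
    show "equiv (carr F) \<kappa>"
      by (rule equivI) (auto simp: \<kappa>_def refl_on_def sym_def trans_def)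
  qed (use qf(1) in \<open>auto simp: \<kappa>_def closedD[OF F] mv_hom_def\<close>)
  moreover have "R' \<subseteq> \<kappa>"
  proof -
    have "R \<subseteq> mv_cong_gen F R"
      by (rule cong_gen(2)[OF F kR(2)])
    then have "f x = f y" if "(x, y) \<in> R" for x y
      using that kR(2) ker by blast
    moreover have "?q (f b) = ?q (f \<zero>\<^bsub>F\<^esub>)"
    proof -
      interpret mv_algebra A by (rule A)
      show ?thesis
        using f(1) c b by (simp add: q(3) zero_closed zero_plus mv_hom_def)
    qed
    ultimately show ?thesis
      using kR(2) b closedD(1)[OF F] by (auto simp: R'_def \<kappa>_def)
  qed
  ultimately have sub: "mv_cong_gen F R' \<subseteq> \<kappa>"
    by (rule cg(3))
  have "mv_isomorphic (mv_quot_elem A c) (mv_quot F (mv_cong_gen F R'))"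
  proof (rule isomorphic_quot_kernel[OF F qf cg(1)])
    fix x y assume xy: "x \<in> carr F" "y \<in> carr F"
    show "(x, y) \<in> mv_cong_gen F R' \<longleftrightarrow> (?q \<circ> f) x = (?q \<circ> f) y"
    proof
      assume "(x, y) \<in> mv_cong_gen F R'"
      then show "(?q \<circ> f) x = (?q \<circ> f) y"
        using sub by (auto simp: \<kappa>_def)
    next
      assume "(?q \<circ> f) x = (?q \<circ> f) y"
      then have "f (x \<oplus>\<^bsub>F\<^esub> b) = f (y \<oplus>\<^bsub>F\<^esub> b)"
        using xy b by (simp add: q(3) f_in f_plus)
      then have "(x \<oplus>\<^bsub>F\<^esub> b, y \<oplus>\<^bsub>F\<^esub> b) \<in> mv_cong_gen F R"
        using xy b by (simp add: ker closedD[OF F])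
      moreover have "mv_cong_gen F R \<subseteq> mv_cong_gen F R'"
        using cg(1,2) by (intro cong_gen(3)[OF F kR(2)]) (auto simp: R'_def)
      ultimately have xyb: "(x \<oplus>\<^bsub>F\<^esub> b, y \<oplus>\<^bsub>F\<^esub> b) \<in> mv_cong_gen F R'"
        by blast
      have eq: "equiv (carr F) (mv_cong_gen F R')"
        using cg(1) by (simp add: mv_congruence_def)
      have absorb: "(z \<oplus>\<^bsub>F\<^esub> b, z) \<in> mv_cong_gen F R'" if "z \<in> carr F" for z
      proof -
        have "(z, z) \<in> mv_cong_gen F R'" "(b, \<zero>\<^bsub>F\<^esub>) \<in> mv_cong_gen F R'"
          using eq that cg(2) by (auto simp: R'_def equiv_def refl_on_def)
        then have "(z \<oplus>\<^bsub>F\<^esub> b, z \<oplus>\<^bsub>F\<^esub> \<zero>\<^bsub>F\<^esub>) \<in> mv_cong_gen F R'"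
          using cg(1) unfolding mv_congruence_def by blast
        then show ?thesis using that by (simp add: zero)
      qed
      show "(x, y) \<in> mv_cong_gen F R'"
        using absorb[OF xy(1)] absorb[OF xy(2)] xyb eq by (meson equivE symD transD)
    qed
  qed
  then show ?thesis
    using model_surj_image[OF model q(1,2)] R' unfolding finitely_presentable_def F_def by blast
qed

lemma generates_induct:
  assumes "mv_generates A X" "mv_subalgebra A {a \<in> carr A. P a}" "\<And>x. x \<in> X \<Longrightarrow> P x" "a \<in> carr A"
  shows "P a"
proof -
  have "carr A \<subseteq> {a \<in> carr A. P a}"
    using assms(1-3) unfolding mv_generates_def by blast
  then show ?thesis using assms(4) by blast
qed

lemma subalgebra_vimage:
  assumes "mv_closed A" "mv_hom A B p" "mv_subalgebra B S"
  shows "mv_subalgebra A {a \<in> carr A. p a \<in> S}"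
  using assms closedD[OF assms(1)] by (auto simp: mv_subalgebra_def mv_hom_def)

lemma fp_generates:
  assumes fp: "finitely_presentable (Komori_theory I J) A"
  obtains xs where "mv_generates A (set xs)"
proof -
  obtain k R f where f: "mv_hom (komori_free I J k) A f" "f ` carr (komori_free I J k) = carr A"
    by (rule fp_presentation[OF fp]) (rule that)
  obtain g where g: "mv_hom (mv_term_algebra k) (komori_free I J k) g"
    "g ` carr (mv_term_algebra k) = carr (komori_free I J k)"
    using komori_free_proj by blast
  define h where "h = f \<circ> g"
  have h: "mv_hom (mv_term_algebra k) A h" "h ` carr (mv_term_algebra k) = carr A"
    using hom_comp[OF g(1) f(1)] g(2) f(2) by (auto simp only: h_def image_comp[symmetric])
  have var: "Var i \<in> carr (mv_term_algebra k)" if "i < k" for i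
    using that by (simp add: mv_term_algebra_def)
  have "h t \<in> S" if "mv_subalgebra A S" "(\<lambda>i. h (Var i)) ` {..<k} \<subseteq> S" "t \<in> carr (mv_term_algebra k)" for S t
    using that(3)
  proof (induction t)
    case (Var i)
    then show ?case using that(2) by (auto simp: mv_term_algebra_def)
  next
    case (Plus s t)
    then show ?case using that(1) h(1) by (auto simp: mv_term_algebra_def mv_hom_def mv_subalgebra_def)
  next
    case (Neg t)
    then show ?case using that(1) h(1) by (auto simp: mv_term_algebra_def mv_hom_def mv_subalgebra_def)
  next
    case Zero
    then show ?case using that(1) h(1) by (auto simp: mv_term_algebra_def mv_hom_def mv_subalgebra_def)
  qed
  then have sub: "carr A \<subseteq> S" if "mv_subalgebra A S" "(\<lambda>i. h (Var i)) ` {..<k} \<subseteq> S" for S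
    using that unfolding h(2)[symmetric] by blast
  have gen: "(\<lambda>i. h (Var i)) ` {..<k} \<subseteq> carr A"
    using h(2) var by blast
  have "mv_subalgebra A (carr A)"
    using fp mv_algebra.mv_closed unfolding finitely_presentable_def mv_model_def mv_closed_def by blast
  with sub gen have "mv_generates A ((\<lambda>i. h (Var i)) ` {..<k})"
    unfolding mv_generates_def by blast
  then show ?thesis
    by (intro that[of "map (\<lambda>i. h (Var i)) [0..<k]"]) (simp add: atLeast0LessThan)
qed

section \<open>Product diagrams\<close>

lemma hom_in: "mv_hom A B f \<Longrightarrow> x \<in> carr A \<Longrightarrow> f x \<in> carr B"
  by (auto simp: mv_hom_def)

text \<open>
  Injectivity and surjectivity of the map into the product, phrased with a list of components, so
  that factors can be split or dropped by induction on the list.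
\<close>
definition list_diagram :: "'a mv \<Rightarrow> ('a mv \<times> ('a \<Rightarrow> 'a)) list \<Rightarrow> bool" where
  "list_diagram A Ds \<longleftrightarrow> (\<forall>D\<in>set Ds. mv_hom A (fst D) (snd D)) \<and>
    (\<forall>a\<in>carr A. \<forall>b\<in>carr A. (\<forall>D\<in>set Ds. snd D a = snd D b) \<longrightarrow> a = b) \<and>
    (\<forall>ys. list_all2 (\<lambda>D y. y \<in> carr (fst D)) Ds ys \<longrightarrow> (\<exists>a\<in>carr A. map (\<lambda>D. snd D a) Ds = ys))"

lemma list_diagram_product:
  assumes D: "list_diagram A Ds" and A: "mv_closed A"
  shows "mv_product_diagram A Ds"
proof -
  let ?f = "\<lambda>a. \<lambda>i\<in>{..<length Ds}. snd (Ds ! i) a"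
  have homs: "mv_hom A (fst (Ds ! i)) (snd (Ds ! i))" if "i < length Ds" for i
    using D that by (auto simp: list_diagram_def)
  have "mv_hom A (mv_prod {..<length Ds} (\<lambda>i. fst (Ds ! i))) ?f"
    using homs unfolding mv_hom_def mv_prod_def
    by (auto simp: image_subset_iff intro!: restrict_ext)
  moreover have "inj_on ?f (carr A)"
  proof (rule inj_onI)
    fix a b assume ab: "a \<in> carr A" "b \<in> carr A" and e: "?f a = ?f b"
    have "snd (Ds ! i) a = snd (Ds ! i) b" if "i < length Ds" for i
      using fun_cong[OF e, of i] that by simp
    then have "\<forall>D\<in>set Ds. snd D a = snd D b"
      by (metis in_set_conv_nth)
    then show "a = b"
      using D ab unfolding list_diagram_def by blast
  qed
  moreover have "?f ` carr A = (\<Pi>\<^sub>E i\<in>{..<length Ds}. carr (fst (Ds ! i)))"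
  proof
    show "?f ` carr A \<subseteq> (\<Pi>\<^sub>E i\<in>{..<length Ds}. carr (fst (Ds ! i)))"
      using homs by (intro image_subsetI) (auto simp: restrict_PiE_iff Pi_iff intro!: hom_in[OF homs])
    show "(\<Pi>\<^sub>E i\<in>{..<length Ds}. carr (fst (Ds ! i))) \<subseteq> ?f ` carr A"
    proof
      fix y assume y: "y \<in> (\<Pi>\<^sub>E i\<in>{..<length Ds}. carr (fst (Ds ! i)))"
      then have "list_all2 (\<lambda>D y. y \<in> carr (fst D)) Ds (map y [0..<length Ds])"
        by (auto simp: list_all2_conv_all_nth)
      then obtain a where a: "a \<in> carr A" "map (\<lambda>D. snd D a) Ds = map y [0..<length Ds]"
        using D unfolding list_diagram_def by blast
      have "snd (Ds ! i) a = y i" if "i < length Ds" for i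
        using arg_cong[OF a(2), of "\<lambda>l. l ! i"] that by simp
      then have "?f a = y"
        using y by (auto simp: PiE_def extensional_def restrict_def fun_eq_iff)
      then show "y \<in> ?f ` carr A"
        using a(1) by blast
    qed
  qed
  ultimately show ?thesis
    by (simp add: mv_product_diagram_def mv_iso_def bij_betw_def mv_prod_def)
qed

text \<open>
  Trivial factors can be dropped: their components impose no condition.
\<close>
lemma list_diagram_filter:
  assumes D: "list_diagram A Ds" and triv: "\<And>D. D \<in> set Ds \<Longrightarrow> \<not> P D \<Longrightarrow> carr (fst D) = {\<zero>\<^bsub>fst D\<^esub>}"
  shows "list_diagram A (filter P Ds)"
  unfolding list_diagram_def
proof (intro conjI ballI allI impI)
  show "mv_hom A (fst D) (snd D)" if "D \<in> set (filter P Ds)" for D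
    using D that by (auto simp: list_diagram_def)
  show "a = b" if ab: "a \<in> carr A" "b \<in> carr A" and e: "\<forall>D\<in>set (filter P Ds). snd D a = snd D b" for a b
  proof -
    have "snd D a = snd D b" if "D \<in> set Ds" for D
    proof (cases "P D")
      case False
      have "mv_hom A (fst D) (snd D)"
        using D that by (simp add: list_diagram_def)
      then have "snd D a \<in> carr (fst D)" "snd D b \<in> carr (fst D)"
        using ab by (auto simp: mv_hom_def)
      then show ?thesis
        using triv[OF that False] by auto
    next
      case True
      then show ?thesis using bspec[OF e, of D] that by simp
    qed
    then show ?thesis
      using D ab unfolding list_diagram_def by blast
  qed
  show "\<exists>a\<in>carr A. map (\<lambda>D. snd D a) (filter P Ds) = ys"
    if ys: "list_all2 (\<lambda>D y. y \<in> carr (fst D)) (filter P Ds) ys" for ys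
  proof -
    have "\<exists>zs. list_all2 (\<lambda>D y. y \<in> carr (fst D)) Ds zs \<and>
        (\<forall>a. map (\<lambda>D. snd D a) Ds = zs \<longrightarrow> map (\<lambda>D. snd D a) (filter P Ds) = ys)"
      using ys triv
    proof (induction Ds arbitrary: ys)
      case (Cons D Ds)
      show ?case
      proof (cases "P D")
        case True
        then obtain y ys' where y: "ys = y # ys'" "y \<in> carr (fst D)"
            "list_all2 (\<lambda>D y. y \<in> carr (fst D)) (filter P Ds) ys'"
          using Cons.prems(1) by (auto simp: list_all2_Cons1)
        obtain zs where "list_all2 (\<lambda>D y. y \<in> carr (fst D)) Ds zs"
          "\<forall>a. map (\<lambda>D. snd D a) Ds = zs \<longrightarrow> map (\<lambda>D. snd D a) (filter P Ds) = ys'"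
          using Cons.IH[OF y(3)] Cons.prems(2) by auto
        then show ?thesis
          using True y by (intro exI[of _ "y # zs"]) auto
      next
        case False
        obtain zs where "list_all2 (\<lambda>D y. y \<in> carr (fst D)) Ds zs"
          "\<forall>a. map (\<lambda>D. snd D a) Ds = zs \<longrightarrow> map (\<lambda>D. snd D a) (filter P Ds) = ys"
          using Cons.IH[of ys] Cons.prems False by auto
        then show ?thesis
          using False Cons.prems(2)[of D] by (intro exI[of _ "\<zero>\<^bsub>fst D\<^esub> # zs"]) auto
      qed
    qed auto
    then show ?thesis
      using D unfolding list_diagram_def by metis
  qed
qed

lemma (in komori) boolean_quotients:
  assumes z: "z \<in> carr A"
  defines "c \<equiv> J1 n A z"
  shows "u \<in> carr A \<Longrightarrow> v \<in> carr A \<Longrightarrow> mv_proj_elem A c u = mv_proj_elem A c v \<Longrightarrow>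
      mv_proj_elem A (\<sim> c) u = mv_proj_elem A (\<sim> c) v \<Longrightarrow> u = v"
    "y1 \<in> carr (mv_quot_elem A c) \<Longrightarrow> y2 \<in> carr (mv_quot_elem A (\<sim> c)) \<Longrightarrow>
      \<exists>u\<in>carr A. mv_proj_elem A c u = y1 \<and> mv_proj_elem A (\<sim> c) u = y2"
    "J1 n (mv_quot_elem A c) (mv_proj_elem A c z) = \<zero>\<^bsub>mv_quot_elem A c\<^esub>"
    "J1 n (mv_quot_elem A (\<sim> c)) (mv_proj_elem A (\<sim> c) z) = \<one>\<^bsub>mv_quot_elem A (\<sim> c)\<^esub>"
proof -
  have c: "c \<in> carr A" "c \<oplus> c = c" "\<sim> c \<in> carr A" "\<sim> c \<oplus> \<sim> c = \<sim> c"
    using z J1_J1 neg_J1 by (simp_all add: c_def closed)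
  note q1 = quot_boolean[OF mv_algebra_axioms c(1,2)] and q2 = quot_boolean[OF mv_algebra_axioms c(3,4)]
  show "u = v" if "u \<in> carr A" "v \<in> carr A" "mv_proj_elem A c u = mv_proj_elem A c v"
      "mv_proj_elem A (\<sim> c) u = mv_proj_elem A (\<sim> c) v"
    using that boolean_split[OF that(1) z] boolean_split[OF that(2) z]
    by (simp add: q1(3) q2(3) c_def[symmetric])
  show "\<exists>u\<in>carr A. mv_proj_elem A c u = y1 \<and> mv_proj_elem A (\<sim> c) u = y2"
    if y: "y1 \<in> carr (mv_quot_elem A c)" "y2 \<in> carr (mv_quot_elem A (\<sim> c))"
  proof -
    obtain x y where xy: "x \<in> carr A" "y \<in> carr A" "y1 = mv_proj_elem A c x" "y2 = mv_proj_elem A (\<sim> c) y"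
      using y q1(2) q2(2) by blast
    define w where "w = (x \<oplus> c) \<odot> (y \<oplus> \<sim> c)"
    have "w \<in> carr A"
      using xy c by (simp add: w_def mv_times_def closed)
    moreover have "w \<oplus> c = x \<oplus> c" "w \<oplus> \<sim> c = y \<oplus> \<sim> c"
      using boolean_glue[OF xy(1,2) z] by (simp_all add: w_def c_def)
    ultimately show ?thesis
      using xy by (intro bexI[of _ w]) (simp_all add: q1(3) q2(3))
  qed
  have "mv_proj_elem A c c = mv_proj_elem A c \<zero>"
    using c by (simp add: q1(3) zero_closed zero_plus)
  then show "J1 n (mv_quot_elem A c) (mv_proj_elem A c z) = \<zero>\<^bsub>mv_quot_elem A c\<^esub>"
    using hom_ops(1)[OF mv_closed q1(1) z] q1(1) by (simp add: c_def mv_hom_def)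
  have "mv_proj_elem A (\<sim> c) c = mv_proj_elem A (\<sim> c) \<one>"
    using c by (simp add: q2(3) one_closed plus_one neg_plus_self)
  then show "J1 n (mv_quot_elem A (\<sim> c)) (mv_proj_elem A (\<sim> c) z) = \<one>\<^bsub>mv_quot_elem A (\<sim> c)\<^esub>"
    using hom_ops(1)[OF mv_closed q2(1) z] q2(1) zero_closed by (simp add: c_def mv_hom_def mv_one_def)
qed

lemma hom_one: "mv_closed A \<Longrightarrow> mv_hom A B f \<Longrightarrow> f \<one>\<^bsub>A\<^esub> = \<one>\<^bsub>B\<^esub>"
  by (simp add: mv_one_def mv_hom_def closedD)

lemma J1_step_eq:
  "J1_step n x (B, p) = (let c = J1 n B (p x) in
    [(mv_quot_elem B c, mv_proj_elem B c \<circ> p),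
     (mv_quot_elem B (\<sim>\<^bsub>B\<^esub> c), mv_proj_elem B (\<sim>\<^bsub>B\<^esub> c) \<circ> p)])"
  by (simp add: J1_step_def J1_def)

lemma list_diagram_step:
  assumes D: "list_diagram A Ds" and x: "x \<in> carr A"
    and komori: "\<And>D. D \<in> set Ds \<Longrightarrow> komori (fst D) n"
  shows "list_diagram A (concat (map (J1_step n x) Ds))"
proof -
  have hom: "mv_hom A (fst D) (snd D)" if "D \<in> set Ds" for D
    using D that by (simp add: list_diagram_def)
  have Dh: "snd D a \<in> carr (fst D)" if "D \<in> set Ds" "a \<in> carr A" for D a
    by (rule hom_in[OF hom[OF that(1)] that(2)])
  define c where "c D = J1 n (fst D) (snd D x)" for D :: "'a mv \<times> ('a \<Rightarrow> 'a)"
  define nc where "nc D = \<sim>\<^bsub>fst D\<^esub> (c D)" for D :: "'a mv \<times> ('a \<Rightarrow> 'a)"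
  have step: "J1_step n x D = [(mv_quot_elem (fst D) (c D), mv_proj_elem (fst D) (c D) \<circ> snd D),
       (mv_quot_elem (fst D) (nc D), mv_proj_elem (fst D) (nc D) \<circ> snd D)]" for D
    using J1_step_eq[of n x "fst D" "snd D"] by (simp add: c_def nc_def Let_def)
  have q: "mv_hom (fst D) (mv_quot_elem (fst D) (c D)) (mv_proj_elem (fst D) (c D))"
    "mv_hom (fst D) (mv_quot_elem (fst D) (nc D)) (mv_proj_elem (fst D) (nc D))" if "D \<in> set Ds" for D
  proof -
    interpret komori "fst D" n by (rule komori[OF that])
    have "snd D x \<in> carr (fst D)" by (rule Dh[OF that x])
    then show "mv_hom (fst D) (mv_quot_elem (fst D) (c D)) (mv_proj_elem (fst D) (c D))"
      "mv_hom (fst D) (mv_quot_elem (fst D) (nc D)) (mv_proj_elem (fst D) (nc D))"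
      using J1_J1 neg_J1 by (auto simp: c_def nc_def closed intro!: quot_boolean(1)[OF mv_algebra_axioms])
  qed
  show ?thesis
    unfolding list_diagram_def
  proof (intro conjI ballI allI impI)
    show "mv_hom A (fst E) (snd E)" if E: "E \<in> set (concat (map (J1_step n x) Ds))" for E
    proof -
      obtain D where D: "D \<in> set Ds" "E \<in> set (J1_step n x D)"
        using E by auto
      then show ?thesis
        using hom_comp[OF hom[OF D(1)] q(1)[OF D(1)]] hom_comp[OF hom[OF D(1)] q(2)[OF D(1)]]
        by (auto simp: step)
    qed
    show "a = b" if ab: "a \<in> carr A" "b \<in> carr A"
      and e: "\<forall>E\<in>set (concat (map (J1_step n x) Ds)). snd E a = snd E b" for a b
    proof -
      have "snd D a = snd D b" if D: "D \<in> set Ds" for D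
      proof (rule komori.boolean_quotients(1)[OF komori[OF D] Dh[OF D x] Dh[OF D ab(1)] Dh[OF D ab(2)]])
        have "\<forall>E\<in>set (J1_step n x D). snd E a = snd E b"
          using e D by auto
        then show "mv_proj_elem (fst D) (J1 n (fst D) (snd D x)) (snd D a) =
            mv_proj_elem (fst D) (J1 n (fst D) (snd D x)) (snd D b)"
          "mv_proj_elem (fst D) (\<sim>\<^bsub>fst D\<^esub> (J1 n (fst D) (snd D x))) (snd D a) =
            mv_proj_elem (fst D) (\<sim>\<^bsub>fst D\<^esub> (J1 n (fst D) (snd D x))) (snd D b)"
          by (simp_all add: step c_def nc_def)
      qed
      then show ?thesis
        using D ab unfolding list_diagram_def by blast
    qed
    fix zs assume zs: "list_all2 (\<lambda>E y. y \<in> carr (fst E)) (concat (map (J1_step n x) Ds)) zs"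
    have "\<exists>ys. list_all2 (\<lambda>D y. y \<in> carr (fst D)) Ds ys \<and>
        (\<forall>a. map (\<lambda>D. snd D a) Ds = ys \<longrightarrow> map (\<lambda>E. snd E a) (concat (map (J1_step n x) Ds)) = zs)"
      using zs komori Dh[OF _ x]
    proof (induction Ds arbitrary: zs)
      case (Cons D Ds)
      obtain z1 z2 zs' where z: "zs = z1 # z2 # zs'" "z1 \<in> carr (mv_quot_elem (fst D) (c D))"
          "z2 \<in> carr (mv_quot_elem (fst D) (nc D))"
          "list_all2 (\<lambda>E y. y \<in> carr (fst E)) (concat (map (J1_step n x) Ds)) zs'"
        using Cons.prems(1) by (auto simp: step[of D] list_all2_Cons1)
      obtain ys where ys: "list_all2 (\<lambda>D y. y \<in> carr (fst D)) Ds ys"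
        "\<forall>a. map (\<lambda>D. snd D a) Ds = ys \<longrightarrow> map (\<lambda>E. snd E a) (concat (map (J1_step n x) Ds)) = zs'"
        using Cons.IH[OF z(4)] Cons.prems(2,3) by auto
      obtain u where "u \<in> carr (fst D)" "mv_proj_elem (fst D) (c D) u = z1" "mv_proj_elem (fst D) (nc D) u = z2"
        using komori.boolean_quotients(2)[of "fst D" n "snd D x"] Cons.prems(2,3)[of D] z(2,3)
        unfolding c_def nc_def by auto
      then show ?case
        using ys z(1) by (intro exI[of _ "u # ys"]) (auto simp: step[of D])
    qed auto
    then show "\<exists>a\<in>carr A. map (\<lambda>E. snd E a) (concat (map (J1_step n x) Ds)) = zs"
      using D unfolding list_diagram_def by metis
  qed
qed

lemma multicomposition_snoc:
  "J1_multicomposition n A (xs @ [x]) = concat (map (J1_step n x) (J1_multicomposition n A xs))"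
  by (simp add: J1_multicomposition_def)

section \<open>Multicomposition and local factors\<close>

context
  fixes I J :: "nat set" and n :: nat and A :: "'a mv"
  assumes IJ: "finite I" "finite J" "\<forall>m\<in>I \<union> J. 0 < m" and n: "n = Lcm (I \<union> J)"
    and fp: "finitely_presentable (Komori_theory I J) A"
begin

lemma fp_komori: "finitely_presentable (Komori_theory I J) B \<Longrightarrow> komori B n"
  by (rule komori_model[OF IJ n]) (simp add: finitely_presentable_def)

text \<open>
  For lists other than generators too: the factorization into local algebras below splits by the
  defects of the generators.
\<close>
lemma multicomposition_factors:
  assumes "set xs \<subseteq> carr A" "(B, p) \<in> set (J1_multicomposition n A xs)"
  shows "finitely_presentable (Komori_theory I J) B \<and> mv_hom A B p \<and> p ` carr A = carr B \<and>
    (\<forall>x\<in>set xs. J1 n B (p x) \<in> {\<zero>\<^bsub>B\<^esub>, \<one>\<^bsub>B\<^esub>})"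
  using assms
proof (induction xs arbitrary: B p rule: rev_induct)
  case Nil
  then show ?case
    using fp by (auto simp: J1_multicomposition_def mv_hom_def finitely_presentable_def mv_model_def mv_algebra_def)
next
  case (snoc x xs)
  from snoc.prems(2) obtain B' p' where B': "(B', p') \<in> set (J1_multicomposition n A xs)"
    and Bp: "(B, p) \<in> set (J1_step n x (B', p'))"
    unfolding multicomposition_snoc by auto
  have IH: "finitely_presentable (Komori_theory I J) B'" "mv_hom A B' p'" "p' ` carr A = carr B'"
    "\<And>y. y \<in> set xs \<Longrightarrow> J1 n B' (p' y) \<in> {\<zero>\<^bsub>B'\<^esub>, \<one>\<^bsub>B'\<^esub>}"
    using snoc.IH[OF _ B'] snoc.prems(1) by auto
  interpret komori B' n by (rule fp_komori[OF IH(1)])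
  have x: "p' x \<in> carr B'" using IH(3) snoc.prems(1) by auto
  define c where "c = J1 n B' (p' x)"
  have bool: "c \<in> carr B'" "c \<oplus>\<^bsub>B'\<^esub> c = c" "\<sim>\<^bsub>B'\<^esub> c \<in> carr B'" "\<sim>\<^bsub>B'\<^esub> c \<oplus>\<^bsub>B'\<^esub> \<sim>\<^bsub>B'\<^esub> c = \<sim>\<^bsub>B'\<^esub> c"
    using x J1_J1 neg_J1 by (simp_all add: c_def closed)
  obtain e where e: "e = c \<or> e = \<sim>\<^bsub>B'\<^esub> c" and B: "B = mv_quot_elem B' e" "p = mv_proj_elem B' e \<circ> p'"
    using Bp by (auto simp: J1_step_eq c_def Let_def)
  have eb: "e \<in> carr B'" "e \<oplus>\<^bsub>B'\<^esub> e = e"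
    using e bool by auto
  note q = quot_boolean[OF mv_algebra_axioms eb, folded B(1)]
  have "J1 n B (p y) \<in> {\<zero>\<^bsub>B\<^esub>, \<one>\<^bsub>B\<^esub>}" if "y \<in> set (xs @ [x])" for y
  proof (cases "y = x")
    case True
    then show ?thesis
      using e boolean_quotients(3,4)[OF x] by (auto simp: B c_def)
  next
    case False
    then have y: "y \<in> set xs" "p' y \<in> carr B'"
      using that IH(3) snoc.prems(1) by auto
    have "J1 n B (p y) = mv_proj_elem B' e (J1 n B' (p' y))"
      using hom_ops(1)[OF mv_closed q(1) y(2)] by (simp add: B(2))
    then show ?thesis
      using IH(4)[OF y(1)] q(1) hom_one[OF mv_closed q(1)] by (auto simp: mv_hom_def)
  qed
  moreover have "finitely_presentable (Komori_theory I J) B"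
    using fp_quot_boolean[OF IH(1) eb] by (simp add: B)
  moreover have "mv_hom A B p" "p ` carr A = carr B"
    using hom_comp[OF IH(2) q(1)] q(2) IH(3) by (auto simp only: B(2) image_comp[symmetric])
  ultimately show ?case by blast
qed

lemma multicomposition_diagram:
  assumes "set xs \<subseteq> carr A"
  shows "list_diagram A (J1_multicomposition n A xs)"
  using assms
proof (induction xs rule: rev_induct)
  case Nil
  show ?case
    by (auto simp: J1_multicomposition_def list_diagram_def mv_hom_def list_all2_Cons1)
next
  case (snoc x xs)
  show ?case
    unfolding multicomposition_snoc
  proof (rule list_diagram_step)
    show "komori (fst D) n" if "D \<in> set (J1_multicomposition n A xs)" for D
      using multicomposition_factors[of xs "fst D" "snd D"] that snoc.prems fp_komori by auto
  qed (use snoc in auto)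
qed

lemma local_of_generators:
  assumes B: "komori B n" "mv_nontrivial B" and p: "mv_hom A B p" "p ` carr A = carr B"
    and gen: "mv_generates A X" and Fin: "\<And>x. x \<in> X \<Longrightarrow> \<exists>d\<le>n. Fin_defect n B d (p x) = \<zero>\<^bsub>B\<^esub>"
  shows "mv_local B"
proof -
  interpret A: komori A n by (rule fp_komori[OF fp])
  interpret komori B n by fact
  let ?S = "{b \<in> carr B. \<exists>d\<le>n. Fin_defect n B d b = \<zero>\<^bsub>B\<^esub>}"
  have sub: "mv_subalgebra A {a \<in> carr A. p a \<in> ?S}"
    by (rule subalgebra_vimage[OF A.mv_closed p(1) Fin_subalgebra])
  have X: "p x \<in> ?S" if "x \<in> X" for x
    using Fin[OF that] gen that hom_in[OF p(1)] by (auto simp: mv_generates_def)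
  have "p a \<in> ?S" if "a \<in> carr A" for a
    by (rule generates_induct[OF gen sub X that])
  then have "J1 n B b \<in> {\<zero>\<^bsub>B\<^esub>, \<one>\<^bsub>B\<^esub>}" if b: "b \<in> carr B" for b
  proof -
    obtain a where "a \<in> carr A" "b = p a"
      using p(2) b by blast
    then obtain d where "d \<le> n" "Fin_defect n B d b = \<zero>\<^bsub>B\<^esub>"
      using \<open>\<And>a. a \<in> carr A \<Longrightarrow> p a \<in> ?S\<close> by auto
    then show ?thesis
      by (rule J1_of_Fin[OF b])
  qed
  then show ?thesis
    using B(2) local_iff_J1 by blast
qed

text \<open>
  Splitting by all defects of all generators makes each defect \<open>0\<close> or \<open>1\<close> in each factor. Not all
  defects of a generator can be \<open>1\<close>, so in each factor every generator satisfies some \<open>Fin\<close>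
  formula, and the nontrivial factors are local.
\<close>
lemma local_factorization:
  "\<exists>(r::nat) (B :: nat \<Rightarrow> 'a mv).
     (\<forall>i<r. finitely_presentable (Komori_theory I J) (B i) \<and> mv_local (B i)) \<and>
     mv_isomorphic A (mv_prod {..<r} B)"
proof -
  interpret A: komori A n by (rule fp_komori[OF fp])
  obtain xs where gen: "mv_generates A (set xs)"
    by (rule fp_generates[OF fp])
  then have xs: "set xs \<subseteq> carr A"
    by (simp add: mv_generates_def)
  define ys where "ys = [Fin_defect n A d x. x \<leftarrow> xs, d \<leftarrow> [0..<n + 1]]"
  have ys: "set ys \<subseteq> carr A"
    using xs by (auto simp: ys_def intro!: A.closed(7))
  define Ds where "Ds = filter (\<lambda>D. mv_nontrivial (fst D)) (J1_multicomposition n A ys)"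
  have "list_diagram A Ds"
    unfolding Ds_def using multicomposition_diagram[OF ys]
    by (rule list_diagram_filter) (simp add: mv_nontrivial_def)
  then have "mv_product_diagram A Ds"
    by (rule list_diagram_product[OF _ A.mv_closed])
  then have "mv_isomorphic A (mv_prod {..<length Ds} (\<lambda>i. fst (Ds ! i)))"
    unfolding mv_product_diagram_def mv_isomorphic_def by blast
  moreover have "finitely_presentable (Komori_theory I J) B \<and> mv_local B" if "(B, p) \<in> set Ds" for B p
  proof -
    have D: "(B, p) \<in> set (J1_multicomposition n A ys)" "mv_nontrivial B"
      using that by (auto simp: Ds_def)
    have B: "finitely_presentable (Komori_theory I J) B" "mv_hom A B p" "p ` carr A = carr B"
      "\<And>y. y \<in> set ys \<Longrightarrow> J1 n B (p y) \<in> {\<zero>\<^bsub>B\<^esub>, \<one>\<^bsub>B\<^esub>}"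
      using multicomposition_factors[OF ys D(1)] by simp_all
    interpret B: komori B n by (rule fp_komori[OF B(1)])
    have Fin: "\<exists>d\<le>n. Fin_defect n B d (p x) = \<zero>\<^bsub>B\<^esub>" if x: "x \<in> set xs" for x
    proof (rule B.Fin_exists)
      have xA: "x \<in> carr A" using x xs by blast
      show "p x \<in> carr B" by (rule hom_in[OF B(2) xA])
      fix d assume d: "d \<le> n"
      have "Fin_defect n A d x \<in> set ys"
        using d by (auto simp: ys_def simp del: upt_Suc intro!: bexI[OF _ x] imageI)
      then have "J1 n B (p (Fin_defect n A d x)) \<in> {\<zero>\<^bsub>B\<^esub>, \<one>\<^bsub>B\<^esub>}"
        by (rule B(4))
      moreover have "p (Fin_defect n A d x) = Fin_defect n B d (p x)"
        by (rule hom_ops(2)[OF A.mv_closed B(2) xA])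
      ultimately show "Fin_defect n B d (p x) \<in> {\<zero>\<^bsub>B\<^esub>, \<one>\<^bsub>B\<^esub>}"
        using B.Fin_defect_J1[OF \<open>p x \<in> carr B\<close> d] by simp
    qed
    show ?thesis
      using B(1) local_of_generators[OF B.komori_axioms D(2) B(2,3) gen Fin] by blast
  qed
  then have "\<forall>i<length Ds. finitely_presentable (Komori_theory I J) (fst (Ds ! i)) \<and> mv_local (fst (Ds ! i))"
    by (metis nth_mem prod.collapse)
  ultimately show ?thesis
    by (intro exI[of _ "length Ds"] exI[of _ "\<lambda>i. fst (Ds ! i)"] conjI)
qed

lemma multicomposition_local_iff:
  assumes gen: "mv_generates A (set xs)"
  shows "(\<forall>(B, p) \<in> set (J1_multicomposition n A xs). mv_nontrivial B \<longrightarrow> mv_local B) \<longleftrightarrow>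
    (\<forall>(B, p) \<in> set (J1_multicomposition n A xs). \<forall>x \<in> set xs. \<exists>d\<in>{0..n}. mv_Fin B n d (p x))"
proof -
  have xs: "set xs \<subseteq> carr A"
    using gen by (simp add: mv_generates_def)
  have "(mv_nontrivial B \<longrightarrow> mv_local B) \<longleftrightarrow> (\<forall>x \<in> set xs. \<exists>d\<in>{0..n}. mv_Fin B n d (p x))"
    if D: "(B, p) \<in> set (J1_multicomposition n A xs)" for B p
  proof -
    have B: "finitely_presentable (Komori_theory I J) B" "mv_hom A B p" "p ` carr A = carr B"
      using multicomposition_factors[OF xs D] by simp_all
    interpret B: komori B n by (rule fp_komori[OF B(1)])
    have px: "p x \<in> carr B" if "x \<in> set xs" for x
      using hom_in[OF B(2)] xs that by blast
    have Fin: "(\<exists>d\<in>{0..n}. mv_Fin B n d (p x)) \<longleftrightarrow> (\<exists>d\<le>n. Fin_defect n B d (p x) = \<zero>\<^bsub>B\<^esub>)"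
      if "x \<in> set xs" for x
      using px[OF that] by (auto simp: B.Fin_iff_defect)
    show ?thesis
    proof
      assume loc: "mv_nontrivial B \<longrightarrow> mv_local B"
      show "\<forall>x \<in> set xs. \<exists>d\<in>{0..n}. mv_Fin B n d (p x)"
      proof
        fix x assume x: "x \<in> set xs"
        have "Fin_defect n B d (p x) \<in> {\<zero>\<^bsub>B\<^esub>, \<one>\<^bsub>B\<^esub>}" if "d \<le> n" for d
        proof (cases "mv_nontrivial B")
          case True
          with loc have "J1 n B (Fin_defect n B d (p x)) \<in> {\<zero>\<^bsub>B\<^esub>, \<one>\<^bsub>B\<^esub>}"
            using B.local_iff_J1 B.closed(7)[OF px[OF x]] by blast
          then show ?thesis
            using B.Fin_defect_J1[OF px[OF x] that] by simp
        next
          case False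
          then show ?thesis
            using B.closed(7)[OF px[OF x], of n d] by (simp add: mv_nontrivial_def)
        qed
        then show "\<exists>d\<in>{0..n}. mv_Fin B n d (p x)"
          using B.Fin_exists[OF px[OF x]] Fin[OF x] by blast
      qed
    next
      assume "\<forall>x \<in> set xs. \<exists>d\<in>{0..n}. mv_Fin B n d (p x)"
      then have *: "\<exists>d\<le>n. Fin_defect n B d (p x) = \<zero>\<^bsub>B\<^esub>" if "x \<in> set xs" for x
        using Fin that by blast
      show "mv_nontrivial B \<longrightarrow> mv_local B"
        using local_of_generators[OF B.komori_axioms _ B(2,3) gen *] by (rule impI)
    qed
  qed
  then show ?thesis by (intro ball_cong) auto
qed

end

theorem mainTheorem4:
  fixes I J :: "nat set" and n :: nat and A :: "'a mv"
  assumes "finite I" and "finite J" and "I \<union> J \<noteq> {}"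
    and "\<forall>m \<in> I \<union> J. 0 < m"
    and "n = Lcm (I \<union> J)"
    and "finitely_presentable (Komori_theory I J) A" and "mv_nontrivial A"
  shows "(\<exists>(r::nat) (B :: nat \<Rightarrow> 'a mv).
            (\<forall>i<r. finitely_presentable (Komori_theory I J) (B i) \<and> mv_local (B i)) \<and>
            mv_isomorphic A (mv_prod {..<r} B)) \<and>
         (\<forall>xs. mv_generates A (set xs) \<longrightarrow>
            mv_product_diagram A (J1_multicomposition n A xs) \<and>
            ((\<forall>(B, p) \<in> set (J1_multicomposition n A xs). mv_nontrivial B \<longrightarrow> mv_local B) \<longleftrightarrow>
             (\<forall>(B, p) \<in> set (J1_multicomposition n A xs). \<forall>x \<in> set xs.
                \<exists>d\<in>{0..n}. mv_Fin B n d (p x))))"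
proof (intro conjI allI impI)
  note A = assms(1,2,4,5,6)
  show "\<exists>(r::nat) (B :: nat \<Rightarrow> 'a mv).
      (\<forall>i<r. finitely_presentable (Komori_theory I J) (B i) \<and> mv_local (B i)) \<and>
      mv_isomorphic A (mv_prod {..<r} B)"
    by (rule local_factorization[OF A])
  fix xs assume gen: "mv_generates A (set xs)"
  then have "set xs \<subseteq> carr A"
    by (simp add: mv_generates_def)
  moreover have "mv_closed A"
    using assms(6) by (simp add: finitely_presentable_def mv_model_def mv_algebra.mv_closed)
  ultimately show "mv_product_diagram A (J1_multicomposition n A xs)"
    by (intro list_diagram_product multicomposition_diagram[OF A])
  show "(\<forall>(B, p) \<in> set (J1_multicomposition n A xs). mv_nontrivial B \<longrightarrow> mv_local B) \<longleftrightarrow>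
      (\<forall>(B, p) \<in> set (J1_multicomposition n A xs). \<forall>x \<in> set xs. \<exists>d\<in>{0..n}. mv_Fin B n d (p x))"
    by (rule multicomposition_local_iff[OF A gen])
qed

end
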